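(* Let $d\ge2$, $\ell\ge1$, $r\ge1$, $q\in\mathbb N$ and $n,n_1,\dots,n_q\in\{1,\dots,n_{\ell;d}\}$. Then $$\sum_{m_1,\dots,m_r=1}^{n_{\ell;d}}\mathcal G_{\ell m_1,\dots,\ell m_r,\ell n}\;\mathcal G_{\ell m_1,\dots,\ell m_r,\ell n_1,\dots,\ell n_q}=\Big(\frac{n_{\ell;d}}{\mu_d}\Big)^{r-1}\hat\gamma_{\ell;r}\;\mathcal G_{\ell n,\ell n_1,\dots,\ell n_q},$$ where $$\hat\gamma_{\ell;r}=n_{\ell;d}\frac{\mu_{d-1}}{\mu_d}\int_{-1}^1G_{\ell;d}(t)^{r+1}\big(\sqrt{1-t^2}\big)^{d-2}dt.$$
   Context: $\mathbb S^d\subset\mathbb R^{d+1}$ is the unit sphere with surface measure $dx$ and $\mu_d=\int_{\mathbb S^d}dx=\frac{2\pi^{(d+1)/2}}{\Gamma((d+1)/2)}$. For $\ell\ge1$, $n_{\ell;d}=\frac{2\ell+d-1}{\ell}\binom{\ell+d-2}{\ell-1}$ is the dimension of the eigenspace of the Laplace–Beltrami operator on $\mathbb S^d$ with eigenvalue $-\ell(\ell+d-1)$, and $Y_{\ell m}=Y_{\ell,m;d}$, $m=1,\dots,n_{\ell;d}$, is a fixed real $L^2(\mathbb S^d)$-orthonormal basis of it. $G_{\ell;d}$ is the Gegenbauer polynomial of degree $\ell$ normalized by $G_{\ell;d}(1)=1$, characterized by $G_{\ell;d}(\langle x,y\rangle)=\frac{\mu_d}{n_{\ell;d}}\sum_{m=1}^{n_{\ell;d}}Y_{\ell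 m}(x)Y_{\ell m}(y)$ for $x,y\in\mathbb S^d$. The generalized Gaunt integral is $\mathcal G_{\ell n_1,\dots,\ell n_q}=\int_{\mathbb S^d}\prod_{i=1}^qY_{\ell n_i}(x)\,dx$. *)

theory Defs
  imports "HOL-Analysis.Analysis" "HOL-Computational_Algebra.Polynomial"
begin

section \<open>The sphere and its surface measure\<close>

text \<open>
  The sphere \<open>S^d\<close> is \<open>sphere 0 1\<close> in a Euclidean space of dimension \<open>d + 1\<close>.
  The surface measure is the cone measure: the area of \<open>A\<close> is \<open>d + 1\<close> times the volume of
  the cone \<open>{t *\<^sub>R x | 0 < t < 1, x \<in> A}\<close>. Note that \<open>sgn x = x /\<^sub>R norm x\<close>.
\<close>

definition sphere_measure :: "'a::euclidean_space measure" where
  "sphere_measure =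
     distr (scale_measure (of_nat DIM('a)) (restrict_space lborel (ball 0 1 - {0})))
           (restrict_space borel (sphere 0 1)) sgn"

definition sphere_area :: "nat \<Rightarrow> real" where
  "sphere_area d = 2 * pi powr ((real d + 1) / 2) / Gamma ((real d + 1) / 2)"

lemma measurable_sgn_sphere:
  "sgn \<in> measurable (scale_measure c (restrict_space lborel (ball 0 1 - {0})))
                    (restrict_space borel (sphere 0 (1::real) :: 'a::euclidean_space set))"
proof -
  have "(sgn :: 'a \<Rightarrow> 'a) \<in> borel_measurable (restrict_space borel (ball 0 1 - {0}))"
    unfolding sgn_div_norm
    by (intro borel_measurable_continuous_on_restrict continuous_intros) auto
  then have "(sgn :: 'a \<Rightarrow> 'a) \<in> borel_measurable
      (scale_measure c (restrict_space lborel (ball 0 1 - {0})))"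
    by (subst measurable_cong_sets[OF _ refl, where M' = "restrict_space borel (ball 0 1 - {0})"])
      (auto intro!: sets_restrict_space_cong)
  then show ?thesis
    by (rule measurable_restrict_space2[rotated])
      (auto simp: space_scale_measure space_restrict_space norm_sgn)
qed

lemma emeasure_sphere_measure_eq_cone:
  fixes A :: "'a::euclidean_space set"
  assumes "A \<in> sets borel" "A \<subseteq> sphere 0 1"
  shows "emeasure sphere_measure A = of_nat DIM('a) * emeasure lborel {x \<in> ball 0 1 - {0}. sgn x \<in> A}"
proof -
  have A: "A \<in> sets (restrict_space borel (sphere 0 1))"
    using assms by (auto simp: sets_restrict_space)
  have eq: "sgn -` A \<inter> (ball 0 1 - {0}) = {x \<in> ball 0 1 - {0}. sgn x \<in> A}" by auto
  have "emeasure (restrict_space lborel (ball 0 1 - {0})) {x \<in> ball 0 1 - {0}. sgn x \<in> A} =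
      emeasure lborel {x \<in> ball 0 1 - {0}. sgn x \<in> A}"
    by (rule emeasure_restrict_space) auto
  then show ?thesis
    unfolding sphere_measure_def
    by (subst emeasure_distr[OF measurable_sgn_sphere A])
      (simp only: space_scale_measure space_restrict_space emeasure_scale_measure
        space_lborel space_borel Int_UNIV_right eq)
qed

lemma emeasure_sphere_measure:
  assumes "DIM('a::euclidean_space) = d + 1"
  shows "emeasure sphere_measure (sphere 0 1 :: 'a set) = ennreal (sphere_area d)"
proof -
  have eq: "{x \<in> ball 0 1 - {0}. sgn x \<in> sphere 0 1} = ball 0 1 - {0 :: 'a}"
    by (auto simp: norm_sgn)
  have "emeasure lborel (ball 0 1 - {0 :: 'a}) = emeasure lborel (ball 0 1 :: 'a set)"
    by (subst emeasure_Diff) auto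
  also have "\<dots> = ennreal (unit_ball_vol (real DIM('a)))"
    by (subst emeasure_ball) auto
  finally have vol: "emeasure lborel (ball 0 1 - {0 :: 'a}) = ennreal (unit_ball_vol (real DIM('a)))" .
  have "emeasure sphere_measure (sphere 0 1 :: 'a set) =
      of_nat DIM('a) * emeasure lborel (ball 0 1 - {0 :: 'a})"
    by (subst emeasure_sphere_measure_eq_cone) (simp_all only: eq, auto)
  also have "\<dots> = ennreal (real DIM('a) * unit_ball_vol (real DIM('a)))"
    by (simp add: vol ennreal_mult ennreal_of_nat_eq_real_of_nat)
  also have "real DIM('a) * unit_ball_vol (real DIM('a)) = sphere_area d"
  proof -
    have Suc: "Gamma ((real d + 1) / 2 + 1) = (real d + 1) / 2 * Gamma ((real d + 1) / 2)"
      by (rule Gamma_plus1) (auto elim!: nonpos_Ints_cases)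
    have "real DIM('a) = real d + 1" using assms by simp
    then show ?thesis
      unfolding sphere_area_def unit_ball_vol_def by (simp only: Suc) simp
  qed
  finally show ?thesis .
qed


section \<open>Laplace--Beltrami eigenspaces\<close>

text \<open>\<open>Ck_on k U f\<close> is meant for open \<open>U\<close>: the derivatives in it do not refer to points outside \<open>U\<close> then.\<close>

primrec Ck_on :: "nat \<Rightarrow> 'a::euclidean_space set \<Rightarrow> ('a \<Rightarrow> real) \<Rightarrow> bool" where
  "Ck_on 0 U f \<longleftrightarrow> continuous_on U f"
| "Ck_on (Suc k) U f \<longleftrightarrow>
     (\<forall>x\<in>U. f differentiable (at x)) \<and>
     (\<forall>b\<in>Basis. Ck_on k U (\<lambda>x. frechet_derivative f (at x) b))"

definition laplacian :: "('a::euclidean_space \<Rightarrow> real) \<Rightarrow> 'a \<Rightarrow> real" where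
  "laplacian F x =
     (\<Sum>b\<in>Basis. frechet_derivative (\<lambda>y. frechet_derivative F (at y) b) (at x) b)"

text \<open>
  A function on the sphere is represented by a function on the whole space of which only the
  values on the sphere matter. Smoothness and the Laplace--Beltrami operator are those of the
  extension \<open>x \<mapsto> f (sgn x)\<close>, which is constant along rays; restricted to the sphere, the
  Euclidean Laplacian of that extension is the Laplace--Beltrami operator applied to \<open>f\<close>.
\<close>

definition smooth_on_sphere :: "('a::euclidean_space \<Rightarrow> real) \<Rightarrow> bool" where
  "smooth_on_sphere f \<longleftrightarrow> (\<forall>k. Ck_on k (- {0}) (\<lambda>x. f (sgn x)))"

definition laplace_beltrami :: "('a::euclidean_space \<Rightarrow> real) \<Rightarrow> 'a \<Rightarrow> real" where
  "laplace_beltrami f = laplacian (\<lambda>x. f (sgn x))"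

definition sphere_eigenspace :: "real \<Rightarrow> ('a::euclidean_space \<Rightarrow> real) set" where
  "sphere_eigenspace ev =
     {f. smooth_on_sphere f \<and> (\<forall>x\<in>sphere 0 1. laplace_beltrami f x = ev * f x)}"

definition orthonormal_eigenbasis ::
  "real \<Rightarrow> nat set \<Rightarrow> (nat \<Rightarrow> 'a::euclidean_space \<Rightarrow> real) \<Rightarrow> bool" where
  "orthonormal_eigenbasis ev I Y \<longleftrightarrow>
     (\<forall>m\<in>I. Y m \<in> sphere_eigenspace ev) \<and>
     (\<forall>m\<in>I. \<forall>m'\<in>I. (\<integral>x. Y m x * Y m' x \<partial>sphere_measure) = (if m = m' then 1 else 0)) \<and>
     (\<forall>f\<in>sphere_eigenspace ev. \<exists>c. \<forall>x\<in>sphere 0 1. f x = (\<Sum>m\<in>I. c m * Y m x))"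

text \<open>The division is exact, see \<open>real_eigenspace_dim\<close> below.\<close>

definition eigenspace_dim :: "nat \<Rightarrow> nat \<Rightarrow> nat" where
  "eigenspace_dim l d = (2 * l + d - 1) * ((l + d - 2) choose (l - 1)) div l"

lemma real_eigenspace_dim:
  assumes "l \<ge> 1" "d \<ge> 2"
  shows "real (eigenspace_dim l d) =
           (2 * real l + real d - 1) / real l * real ((l + d - 2) choose (l - 1))"
proof -
  obtain k where k: "l = Suc k" using assms(1) by (cases l) auto
  obtain e where e: "d = e + 2" using assms(2) by (metis le_add_diff_inverse2)
  have "(2 * l + d - 1) * ((l + d - 2) choose (l - 1)) =
      l * ((Suc (k + e + 1)) choose l) + l * ((l + d - 2) choose (l - 1))"
    using Suc_times_binomial_eq[of "k + e + 1" k]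
    by (simp add: k e algebra_simps)
  then have "l dvd (2 * l + d - 1) * ((l + d - 2) choose (l - 1))"
    by (metis dvd_add dvd_triv_left)
  then have "real (eigenspace_dim l d) =
      real ((2 * l + d - 1) * ((l + d - 2) choose (l - 1))) / real l"
    unfolding eigenspace_dim_def by (rule real_of_nat_div)
  then show ?thesis
    using assms by (simp add: of_nat_diff)
qed


section \<open>Gegenbauer polynomials\<close>

text \<open>\<open>gegenbauer a n\<close> is the classical Gegenbauer polynomial with parameter \<open>a\<close> and degree \<open>n\<close>.\<close>

fun gegenbauer :: "real \<Rightarrow> nat \<Rightarrow> real poly" where
  "gegenbauer a 0 = 1"
| "gegenbauer a (Suc 0) = [:0, 2 * a:]"
| "gegenbauer a (Suc (Suc n)) =
     smult (1 / (real n + 2))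
       (smult (2 * (real n + 1 + a)) ([:0, 1:] * gegenbauer a (Suc n))
        - smult (real n + 2 * a) (gegenbauer a n))"

text \<open>For \<open>S^d\<close> the parameter is \<open>(d - 1) / 2\<close>, and the value at \<open>1\<close> is normalized to \<open>1\<close>.\<close>

definition sphere_gegenbauer :: "nat \<Rightarrow> nat \<Rightarrow> real poly" where
  "sphere_gegenbauer l d =
     (let C = gegenbauer ((real d - 1) / 2) l in smult (1 / poly C 1) C)"

lemma gegenbauer_at_1: "poly (gegenbauer a n) 1 = pochhammer (2 * a) n / fact n"
proof (induction a n rule: gegenbauer.induct)
  case (3 a n)
  have "2 * (real n + 1 + a) * (pochhammer (2 * a) (Suc n) / fact (Suc n))
      - (real n + 2 * a) * (pochhammer (2 * a) n / fact n)
     = (real n + 2) * (pochhammer (2 * a) (Suc (Suc n)) / fact (Suc (Suc n)))"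
    by (simp add: pochhammer_Suc divide_simps) (simp add: algebra_simps)
  moreover have "poly (gegenbauer a (Suc (Suc n))) 1 =
      (2 * (real n + 1 + a) * poly (gegenbauer a (Suc n)) 1
       - (real n + 2 * a) * poly (gegenbauer a n) 1) / (real n + 2)"
    by simp
  ultimately show ?case
    unfolding 3 by simp
qed auto

lemma sphere_gegenbauer_at_1:
  assumes "d \<ge> 2"
  shows "poly (sphere_gegenbauer l d) 1 = 1"
proof -
  have "2 * ((real d - 1) / 2) = real d - 1" by simp
  then show ?thesis
    using assms pochhammer_pos[of "real d - 1" l]
    by (simp only: sphere_gegenbauer_def Let_def gegenbauer_at_1 poly_smult) simp
qed


section \<open>Gaunt integrals\<close>

definition gaunt :: "(nat \<Rightarrow> 'a::euclidean_space \<Rightarrow> real) \<Rightarrow> nat list \<Rightarrow> real" where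
  "gaunt Y ns = (\<integral>x. (\<Prod>k\<leftarrow>ns. Y k x) \<partial>sphere_measure)"

definition gamma_hat :: "nat \<Rightarrow> nat \<Rightarrow> nat \<Rightarrow> real" where
  "gamma_hat l r d =
     real (eigenspace_dim l d) * (sphere_area (d - 1) / sphere_area d) *
     (LBINT t:{-1..1}. poly (sphere_gegenbauer l d) t ^ (r + 1) * sqrt (1 - t\<^sup>2) ^ (d - 2))"

end

theory Submission
  imports Defs
begin

text \<open>
  Summing over \<open>m\<^sub>1, \<dots>, m\<^sub>r\<close> turns the left-hand side into the double integral of
  \<open>Z(x, y)\<^sup>r Y\<^sub>n(x) \<Prod>\<^sub>i Y\<^sub>n\<^sub>i(y)\<close> with \<open>Z(x, y) = \<Sum>\<^sub>m Y\<^sub>m(x) Y\<^sub>m(y)\<close>, so it suffices to know the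
  addition theorem \<open>Z(x, y) = c G(x \<bullet> y)\<close>, \<open>c = N / \<mu>\<^sub>d\<close>, and the Funk--Hecke formula for polynomial kernels.

  The zonal function \<open>G(x \<bullet> y)\<close> is an eigenfunction, so the basis reproduces it; hence
  \<open>\<integral>\<^sub>x (Z - c G)\<^sup>2 = Z(y, y) - c\<close>, provided that \<open>\<integral> G(x \<bullet> y)\<^sup>2 dx = \<mu>\<^sub>d / N\<close>, which is the classical norm of
  the Gegenbauer polynomials. The right-hand side is nonnegative with integral \<open>N - c \<mu>\<^sub>d = 0\<close>, so the addition
  theorem holds for almost all \<open>y\<close>, which is enough under an integral. In particular the \<open>Y\<^sub>m\<close> are almost
  everywhere coefficients of zonal functions, and the Funk--Hecke formula reduces to the orthogonality of
  \<open>C\<^sub>j(x \<bullet> y)\<close> and \<open>C\<^sub>k(x \<bullet> z)\<close> for \<open>j \<noteq> k\<close> by expanding the kernel in Gegenbauer polynomials.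

  That orthogonality is a Green formula, obtained by differentiating the rotation invariance of the surface
  measure. Rotation invariance itself holds because a plane rotation is a product of three shears.
\<close>

section \<open>Gegenbauer polynomials\<close>

lemma gegenbauer_three_term:
  "(real n + 2) * poly (gegenbauer a (Suc (Suc n))) t =
     2 * (real n + 1 + a) * t * poly (gegenbauer a (Suc n)) t - (real n + 2 * a) * poly (gegenbauer a n) t"
  by (simp add: field_simps)

text \<open>The two identities are proved together: differentiating the three-term recurrence leaves
  the derivative of degree n, which the second identity of the hypothesis eliminates. The new second
  identity then follows from the new first one and the recurrence.\<close>

lemma gegenbauer_pderiv_aux:
  "poly (pderiv (gegenbauer a (Suc n))) t =
     t * poly (pderiv (gegenbauer a n)) t + (real n + 2 * a) * poly (gegenbauer a n) t \<and>
   (real n + 1) * poly (gegenbauer a (Suc n)) t =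
     t * poly (pderiv (gegenbauer a (Suc n))) t - poly (pderiv (gegenbauer a n)) t"
proof (induction n)
  case 0
  show ?case by (simp add: pderiv_pCons)
next
  case (Suc n)
  let ?C = "\<lambda>k. poly (gegenbauer a k) t" and ?D = "\<lambda>k. poly (pderiv (gegenbauer a k)) t"
  have D: "(real n + 2) * ?D (Suc (Suc n)) =
      2 * (real n + 1 + a) * (?C (Suc n) + t * ?D (Suc n)) - (real n + 2 * a) * ?D n"
    by (simp add: pderiv_smult pderiv_diff pderiv_mult pderiv_pCons field_simps)
  have Dn: "?D n = t * ?D (Suc n) - (real n + 1) * ?C (Suc n)"
    using Suc.IH by simp
  have "(real n + 2) * ?D (Suc (Suc n)) =
      (real n + 2) * (t * ?D (Suc n) + (real (Suc n) + 2 * a) * ?C (Suc n))"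
    unfolding D Dn by (simp add: algebra_simps)
  then have A: "?D (Suc (Suc n)) = t * ?D (Suc n) + (real (Suc n) + 2 * a) * ?C (Suc n)"
    by (metis add_cancel_right_left add_nonneg_pos mult_cancel_left of_nat_0_le_iff order_less_irrefl zero_less_numeral)
  have "(real n + 2) * ?C (Suc (Suc n)) = t * ?D (Suc (Suc n)) - ?D (Suc n)"
    unfolding A gegenbauer_three_term using Suc.IH by (simp add: algebra_simps) algebra
  then show ?case using A by (simp del: gegenbauer.simps add: algebra_simps)
qed

lemmas gegenbauer_pderiv_Suc = gegenbauer_pderiv_aux[THEN conjunct1]
  and gegenbauer_pderiv_diff = gegenbauer_pderiv_aux[THEN conjunct2]

text \<open>Combining the two first-order identities expresses (1 - t^2) C_n' through C_(n-1) and
  C_n. One more differentiation, with C_(n-1)' eliminated again, yields the second-order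
  equation.\<close>

lemma gegenbauer_ode:
  "(1 - t\<^sup>2) * poly (pderiv (pderiv (gegenbauer a n))) t - (2 * a + 1) * t * poly (pderiv (gegenbauer a n)) t
    = - (real n * (real n + 2 * a)) * poly (gegenbauer a n) t"
proof (cases n)
  case 0
  then show ?thesis by simp
next
  case (Suc n)
  let ?C = "\<lambda>k. gegenbauer a k"
  \<comment> \<open>The relation holds at every t, hence between polynomials, and can therefore be
    differentiated with \<open>pderiv\<close>.\<close>
  have "poly ([:1, 0, -1:] * pderiv (?C (Suc n))) =
      poly (smult (real n + 2 * a) (?C n) - smult (real n + 1) ([:0, 1:] * ?C (Suc n)))"
  proof
    fix t
    show "poly ([:1, 0, -1:] * pderiv (?C (Suc n))) t =
      poly (smult (real n + 2 * a) (?C n) - smult (real n + 1) ([:0, 1:] * ?C (Suc n))) t"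
      using gegenbauer_pderiv_Suc[of a n t] gegenbauer_pderiv_diff[of n a t]
      by (simp del: gegenbauer.simps add: algebra_simps) algebra
  qed
  then have "[:1, 0, -1:] * pderiv (?C (Suc n)) =
      smult (real n + 2 * a) (?C n) - smult (real n + 1) ([:0, 1:] * ?C (Suc n))"
    by (simp only: poly_eq_poly_eq_iff)
  then have eq: "poly (pderiv ([:1, 0, -1:] * pderiv (?C (Suc n)))) t =
      poly (pderiv (smult (real n + 2 * a) (?C n) - smult (real n + 1) ([:0, 1:] * ?C (Suc n)))) t"
    by simp
  have "poly (pderiv ([:1, 0, -1:] * q)) t = (1 - t\<^sup>2) * poly (pderiv q) t - 2 * t * poly q t" for q
    by (simp only: pderiv_mult) (simp add: pderiv_pCons algebra_simps power2_eq_square)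
  moreover have "poly (pderiv ([:0, 1:] * q)) t = t * poly (pderiv q) t + poly q t" for q :: "real poly"
    by (simp only: pderiv_mult) (simp add: pderiv_pCons)
  ultimately have "(1 - t\<^sup>2) * poly (pderiv (pderiv (?C (Suc n)))) t - 2 * t * poly (pderiv (?C (Suc n))) t =
      (real n + 2 * a) * poly (pderiv (?C n)) t
      - (real n + 1) * (t * poly (pderiv (?C (Suc n))) t + poly (?C (Suc n)) t)"
    using eq by (simp only: pderiv_diff pderiv_smult poly_diff poly_smult)
  moreover have "poly (pderiv (?C n)) t = t * poly (pderiv (?C (Suc n))) t - (real n + 1) * poly (?C (Suc n)) t"
    using gegenbauer_pderiv_diff[of n a t] by simp
  ultimately show ?thesis
    unfolding Suc by (simp del: gegenbauer.simps add: algebra_simps)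
qed

text \<open>The lower index \<open>m\<close> is left open because degree 0 has no predecessor; there
  the second coefficient is 0.\<close>

lemma times_X_gegenbauer:
  assumes "a > 0"
  obtains b c m where "[:0, 1:] * gegenbauer a n = smult b (gegenbauer a (Suc n)) + smult c (gegenbauer a m)"
proof (cases n)
  case 0
  then have "[:0, 1:] * gegenbauer a n = smult (1 / (2 * a)) (gegenbauer a (Suc n)) + smult 0 (gegenbauer a 0)"
    using assms by simp
  then show ?thesis by (rule that)
next
  case (Suc k)
  have nz: "2 * (real k + 1 + a) \<noteq> 0" using assms by (auto simp: add_eq_0_iff)
  have "smult (2 * (real k + 1 + a)) ([:0, 1:] * gegenbauer a n) =
     smult (real k + 2) (gegenbauer a (Suc n)) + smult (real k + 2 * a) (gegenbauer a k)"
    by (intro poly_ext) (use gegenbauer_three_term[of k a] in \<open>simp add: Suc del: gegenbauer.simps\<close>)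
  then have "smult (1 / (2 * (real k + 1 + a))) (smult (2 * (real k + 1 + a)) ([:0, 1:] * gegenbauer a n)) =
     smult (1 / (2 * (real k + 1 + a))) (smult (real k + 2) (gegenbauer a (Suc n)) + smult (real k + 2 * a) (gegenbauer a k))"
    by simp
  then have "[:0, 1:] * gegenbauer a n =
     smult (1 / (2 * (real k + 1 + a)) * (real k + 2)) (gegenbauer a (Suc n)) +
     smult (1 / (2 * (real k + 1 + a)) * (real k + 2 * a)) (gegenbauer a k)"
    using nz by (simp only: smult_smult smult_add_right) simp
  then show ?thesis by (rule that)
qed

text \<open>In effect, the Gegenbauer polynomials span. Strengthening the claim to all products
  \<open>p * gegenbauer a k\<close> lets an induction on \<open>p\<close> replace a degree count: a
  factor X only moves to other indices k.\<close>

lemma linear_functional_eq_0: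
  fixes L :: "real poly \<Rightarrow> real"
  assumes add: "\<And>p q. L (p + q) = L p + L q" and smult: "\<And>c p. L (smult c p) = c * L p"
    and "a > 0" and 0: "\<And>k. L (gegenbauer a k) = 0"
  shows "L p = 0"
proof -
  have "\<forall>k. L (p * gegenbauer a k) = 0"
  proof (induction p)
    case 0
    show ?case using smult[of 0 0] by simp
  next
    case (pCons b p)
    show ?case
    proof
      fix k
      obtain u v m where uv: "[:0, 1:] * gegenbauer a k = smult u (gegenbauer a (Suc k)) + smult v (gegenbauer a m)"
        using times_X_gegenbauer \<open>a > 0\<close> by blast
      have "pCons b p * gegenbauer a k = smult b (gegenbauer a k) + p * ([:0, 1:] * gegenbauer a k)"
        by (simp add: mult_pCons_left)
      also have "\<dots> = smult b (gegenbauer a k) + (smult u (p * gegenbauer a (Suc k)) + smult v (p * gegenbauer a m))"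
        unfolding uv by (simp add: distrib_left del: gegenbauer.simps)
      finally show "L (pCons b p * gegenbauer a k) = 0"
        by (simp only: add smult 0 pCons.IH[rule_format] mult_zero_right add_0_right)
    qed
  qed
  then have "L (p * gegenbauer a 0) = 0" by blast
  then show ?thesis by simp
qed

text \<open>Consecutive norms are compared through the mixed value M(X C_n C_(n+1)): expanding X C_n
  or X C_(n+1) by the recurrence leaves, by orthogonality, one square norm each. \<open>M\<close>
  will be the integral of a zonal polynomial over the sphere.\<close>

lemma gegenbauer_norm:
  fixes M :: "real poly \<Rightarrow> real"
  assumes add: "\<And>p q. M (p + q) = M p + M q" and smult: "\<And>c p. M (smult c p) = c * M p"
    and "a > 0" and orth: "\<And>j k. j \<noteq> k \<Longrightarrow> M (gegenbauer a j * gegenbauer a k) = 0"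
  shows "M (gegenbauer a n * gegenbauer a n) = a / (real n + a) * (pochhammer (2 * a) n / fact n) * M 1"
proof (induction n)
  case 0
  then show ?case using \<open>a > 0\<close> by simp
next
  case (Suc n)
  let ?C = "gegenbauer a" and ?X = "[:0, 1:] :: real poly"
  define T where "T = M (?X * ?C n * ?C (Suc n))"
  have pos: "real n + a > 0" "real n + 1 + a > 0" using \<open>a > 0\<close> by auto
  have U: "2 * (real n + a) * T = (real n + 1) * M (?C (Suc n) * ?C (Suc n))"
  \<comment> \<open>The recurrence for X C_n involves a predecessor of n, so n = 0 uses C_1 = 2 a X
    directly.\<close>
  proof (cases n)
    case 0
    have "smult (2 * a) (?X * ?C n * ?C (Suc n)) = ?C (Suc n) * ?C (Suc n)"
      by (simp add: 0 algebra_simps)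
    then show ?thesis unfolding T_def using 0 smult[of "2 * a" "?X * ?C n * ?C (Suc n)"] by simp
  next
    case (Suc k)
    have "smult (2 * (real n + a)) (?X * ?C n * ?C (Suc n)) =
        smult (real n + 1) (?C (Suc n) * ?C (Suc n)) + smult (real k + 2 * a) (?C k * ?C (Suc n))"
    proof (intro poly_ext)
      fix t
      have "poly (?C (Suc n)) t * ((real k + 2) * poly (?C (Suc n)) t) = poly (?C (Suc n)) t *
        (2 * (real k + 1 + a) * t * poly (gegenbauer a (Suc k)) t - (real k + 2 * a) * poly (gegenbauer a k) t)"
        unfolding Suc gegenbauer_three_term[of k a] ..
      then show "poly (smult (2 * (real n + a)) (?X * ?C n * ?C (Suc n))) t =
        poly (smult (real n + 1) (?C (Suc n) * ?C (Suc n)) + smult (real k + 2 * a) (?C k * ?C (Suc n))) t"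
        by (simp add: Suc algebra_simps del: gegenbauer.simps)
    qed
    then show ?thesis
      unfolding T_def using orth[of k "Suc n"] Suc
      by (metis add smult add.right_neutral mult_zero_right n_not_Suc_n lessI less_Suc_eq order_less_irrefl)
  qed
  have V: "2 * (real n + 1 + a) * T = (real n + 2 * a) * M (?C n * ?C n)"
  proof -
    have "smult (2 * (real n + 1 + a)) (?X * ?C n * ?C (Suc n)) =
        smult (real n + 2) (?C (Suc (Suc n)) * ?C n) + smult (real n + 2 * a) (?C n * ?C n)"
    proof (intro poly_ext)
      fix t
      have "poly (?C n) t * ((real n + 2) * poly (?C (Suc (Suc n))) t) = poly (?C n) t *
        (2 * (real n + 1 + a) * t * poly (gegenbauer a (Suc n)) t - (real n + 2 * a) * poly (gegenbauer a n) t)"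
        unfolding gegenbauer_three_term[of n a] ..
      then show "poly (smult (2 * (real n + 1 + a)) (?X * ?C n * ?C (Suc n))) t =
        poly (smult (real n + 2) (?C (Suc (Suc n)) * ?C n) + smult (real n + 2 * a) (?C n * ?C n)) t"
        by (simp add: algebra_simps del: gegenbauer.simps)
    qed
    then have "2 * (real n + 1 + a) * T = (real n + 2) * M (?C (Suc (Suc n)) * ?C n) + (real n + 2 * a) * M (?C n * ?C n)"
      unfolding T_def by (metis add smult)
    then show ?thesis using orth[of "Suc (Suc n)" n] by (simp del: gegenbauer.simps)
  qed
  have "M (?C (Suc n) * ?C (Suc n)) = 2 * (real n + a) * T / (real n + 1)"
    unfolding U by simp
  also have "T = (real n + 2 * a) * M (?C n * ?C n) / (2 * (real n + 1 + a))"
    using V pos by (simp add: field_simps)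
  also have "2 * (real n + a) * \<dots> / (real n + 1) =
      a / (real (Suc n) + a) * (pochhammer (2 * a) (Suc n) / fact (Suc n)) * M 1"
    unfolding Suc.IH using pos by (simp add: pochhammer_Suc divide_simps) (simp add: algebra_simps)
  finally show ?case .
qed

text \<open>The right-hand side is C_l(1). Multiplying the constant of
  \<open>gegenbauer_norm\<close> by the eigenspace dimension therefore produces the square of
  C_l(1), apart from the factor M 1.\<close>

lemma gegenbauer_norm_eigenspace_dim:
  assumes "d \<ge> 2" "l \<ge> 1"
  shows "((real d - 1) / 2) / (real l + (real d - 1) / 2) * real (eigenspace_dim l d)
     = pochhammer (real d - 1) l / fact l"
proof -
  obtain k where k: "l = Suc k" using assms(2) by (cases l) auto
  obtain e where e: "d = e + 2" using assms(1) by (metis le_add_diff_inverse2)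
  have "pochhammer (real d - 1) l = pochhammer (real (Suc e)) l" using e by simp
  also have "\<dots> = fact (e + l) / fact e"
    using pochhammer_product'[of "1::real" e l] using pochhammer_pos[of "1::real" e] by (simp add: pochhammer_fact add.commute)
  finally have p: "pochhammer (real d - 1) l = fact (e + l) / fact e" .
  have b: "real ((l + d - 2) choose (l - 1)) = fact (e + l) / (fact k * fact (Suc e))"
    using binomial_fact[of k "e + l", where ?'a = real] by (simp add: k e add.commute)
  show ?thesis
    unfolding real_eigenspace_dim[OF assms(2,1)] p b
    by (simp add: k e divide_simps) (simp add: algebra_simps)
qed

section \<open>Rotation invariance of the surface measure\<close>

text \<open>The shear adds to the \<open>v\<close>-coordinate an amount fixed by the
  \<open>u\<close>-coordinate. With the \<open>v\<close>-coordinate integrated innermost,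
  translation invariance on the line suffices.\<close>

lemma lborel_distr_shear:
  fixes u v :: "'a::euclidean_space"
  assumes u: "u \<in> Basis" and v: "v \<in> Basis" and "u \<noteq> v"
  shows "distr lborel borel (\<lambda>x. x + (c * (x \<bullet> u)) *\<^sub>R v) = lborel"
proof -
  interpret product_sigma_finite "\<lambda>_::'a. lborel :: real measure" ..
  let ?T = "\<lambda>x::'a. x + (c * (x \<bullet> u)) *\<^sub>R v"
  let ?S = "\<lambda>f. \<Sum>b\<in>Basis. f b *\<^sub>R b :: 'a"
  have insert: "insert v (Basis - {v}) = (Basis :: 'a set)" using v by auto
  have Fubini: "(\<integral>\<^sup>+x. g x \<partial>lborel) = (\<integral>\<^sup>+x. \<integral>\<^sup>+y. g (?S (x(v := y))) \<partial>lborel \<partial>Pi\<^sub>M (Basis - {v}) (\<lambda>_. lborel))"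
    if [measurable]: "g \<in> borel_measurable borel" for g :: "'a \<Rightarrow> ennreal"
  proof -
    have [measurable]: "?S \<in> borel_measurable (Pi\<^sub>M Basis (\<lambda>_. lborel))" by measurable
    have "(\<integral>\<^sup>+x. g x \<partial>lborel) = (\<integral>\<^sup>+f. g (?S f) \<partial>Pi\<^sub>M Basis (\<lambda>_. lborel))"
      by (subst lborel_eq, subst nn_integral_distr) auto
    also have "\<dots> = (\<integral>\<^sup>+f. g (?S f) \<partial>Pi\<^sub>M (insert v (Basis - {v})) (\<lambda>_. lborel))"
      unfolding insert ..
    also have "\<dots> = (\<integral>\<^sup>+x. \<integral>\<^sup>+y. g (?S (x(v := y))) \<partial>lborel \<partial>Pi\<^sub>M (Basis - {v}) (\<lambda>_. lborel))"
      by (rule product_nn_integral_insert) (auto simp: insert)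
    finally show ?thesis .
  qed
  have T: "?T (?S (x(v := y))) = ?S (x(v := y + c * x u))" for x y
  proof (rule euclidean_eqI)
    fix b :: 'a assume "b \<in> Basis"
    then show "?T (?S (x(v := y))) \<bullet> b = ?S (x(v := y + c * x u)) \<bullet> b"
      using assms by (auto simp: inner_simps inner_Basis)
  qed
  have [measurable]: "?T \<in> borel \<rightarrow>\<^sub>M borel" by measurable
  have "(\<integral>\<^sup>+x. g (?T x) \<partial>lborel) = (\<integral>\<^sup>+x. g x \<partial>lborel)"
    if g[measurable]: "g \<in> borel_measurable borel" for g :: "'a \<Rightarrow> ennreal"
  proof -
    have "(\<integral>\<^sup>+y. g (?S (x(v := y + s))) \<partial>lborel) = (\<integral>\<^sup>+y. g (?S (x(v := y))) \<partial>lborel)" for x and s :: real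
    proof -
      have S: "(\<lambda>y. ?S (x(v := y))) = (\<lambda>y. \<Sum>b\<in>Basis. (if b = v then y else x b) *\<^sub>R b)"
        by (auto intro!: sum.cong)
      have "(\<lambda>y. ?S (x(v := y))) \<in> borel \<rightarrow>\<^sub>M borel" unfolding S
        by (intro borel_measurable_sum borel_measurable_scaleR) auto
      then have "(\<lambda>y. g (?S (x(v := y)))) \<in> borel_measurable borel"
        using g by (rule measurable_compose)
      from nn_integral_real_affine[OF this, of 1 s] show ?thesis
        by (simp add: add.commute fun_upd_def)
    qed
    moreover have "(\<integral>\<^sup>+x. g (?T x) \<partial>lborel) =
        (\<integral>\<^sup>+x. \<integral>\<^sup>+y. g (?T (?S (x(v := y)))) \<partial>lborel \<partial>Pi\<^sub>M (Basis - {v}) (\<lambda>_. lborel))"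
      by (rule Fubini) measurable
    ultimately show ?thesis
      unfolding T using Fubini[OF g] by simp
  qed
  then have nn: "(\<integral>\<^sup>+x. indicator A (?T x) \<partial>lborel) = (\<integral>\<^sup>+x. indicator A x \<partial>lborel)"
    if "A \<in> sets borel" for A using that by simp
  show ?thesis
  proof (rule measure_eqI)
    fix A assume "A \<in> sets (distr lborel borel ?T)"
    then have A [measurable]: "A \<in> sets borel" by simp
    have "emeasure (distr lborel borel ?T) A = (\<integral>\<^sup>+x. indicator A x \<partial>distr lborel borel ?T)"
      by (rule nn_integral_indicator[symmetric]) simp
    also have "\<dots> = (\<integral>\<^sup>+x. indicator A (?T x) \<partial>lborel)"
      by (rule nn_integral_distr) simp_all
    finally show "emeasure (distr lborel borel ?T) A = emeasure lborel A"
      using nn[OF A] by simp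
  qed simp
qed

text \<open>Identity plus a correction inside the span of \<open>u\<close> and \<open>v\<close>; for
  orthonormal \<open>u\<close>, \<open>v\<close> it turns \<open>u\<close> towards \<open>v\<close>
  and fixes the orthogonal complement.\<close>

definition plane_rotation :: "'a::euclidean_space \<Rightarrow> 'a \<Rightarrow> real \<Rightarrow> 'a \<Rightarrow> 'a" where
  "plane_rotation u v \<theta> x =
     x + (cos \<theta> - 1) *\<^sub>R ((x \<bullet> u) *\<^sub>R u + (x \<bullet> v) *\<^sub>R v) + sin \<theta> *\<^sub>R ((x \<bullet> u) *\<^sub>R v - (x \<bullet> v) *\<^sub>R u)"

lemma plane_rotation_measurable [measurable]: "plane_rotation u v \<theta> \<in> borel_measurable borel"
  unfolding plane_rotation_def[abs_def] by measurable

lemma plane_rotation_0 [simp]: "plane_rotation u v 0 x = x"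
  by (simp add: plane_rotation_def)

lemma plane_rotation_scaleR: "plane_rotation u v \<theta> (c *\<^sub>R x) = c *\<^sub>R plane_rotation u v \<theta> x"
  by (simp add: plane_rotation_def algebra_simps)

lemma plane_rotation_inner:
  assumes "u \<in> Basis" "v \<in> Basis" "u \<noteq> v"
  shows "plane_rotation u v \<theta> x \<bullet> u = cos \<theta> * (x \<bullet> u) - sin \<theta> * (x \<bullet> v)"
    and "plane_rotation u v \<theta> x \<bullet> v = cos \<theta> * (x \<bullet> v) + sin \<theta> * (x \<bullet> u)"
  using assms by (simp_all add: plane_rotation_def inner_simps inner_Basis algebra_simps)

lemma norm_plane_rotation:
  assumes "u \<in> Basis" "v \<in> Basis" "u \<noteq> v"
  shows "norm (plane_rotation u v \<theta> x) = norm x"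
proof -
  let ?c = "cos \<theta>" and ?s = "sin \<theta>" and ?R = "plane_rotation u v \<theta> x"
  have "?R \<bullet> ?R = ?R \<bullet> x + (?c - 1) * ((x \<bullet> u) * (?R \<bullet> u) + (x \<bullet> v) * (?R \<bullet> v)) +
      ?s * ((x \<bullet> u) * (?R \<bullet> v) - (x \<bullet> v) * (?R \<bullet> u))"
    by (subst (2) plane_rotation_def) (simp add: inner_simps algebra_simps)
  moreover have "?R \<bullet> x = x \<bullet> x + (?c - 1) * ((x \<bullet> u)\<^sup>2 + (x \<bullet> v)\<^sup>2)"
    by (simp add: plane_rotation_def inner_simps inner_commute power2_eq_square algebra_simps)
  ultimately have "?R \<bullet> ?R = x \<bullet> x"
    unfolding plane_rotation_inner[OF assms] using sin_cos_squared_add[of \<theta>] by algebra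
  then show ?thesis by (simp add: norm_eq_sqrt_inner)
qed

text \<open>A shear along \<open>v\<close> with factor sin theta is placed between two shears along
  \<open>u\<close> with factor -tan(theta/2). The half-angle tangent explains the condition on
  theta, which excludes the odd multiples of pi.\<close>

lemma lborel_distr_plane_rotation:
  fixes u v :: "'a::euclidean_space"
  assumes u: "u \<in> Basis" and v: "v \<in> Basis" and "u \<noteq> v" and \<theta>: "cos (\<theta> / 2) \<noteq> 0"
  shows "distr lborel borel (plane_rotation u v \<theta>) = lborel"
proof -
  define S where "S c u v x = x + (c * (x \<bullet> u)) *\<^sub>R v" for c and u v x :: 'a
  define t where "t = - tan (\<theta> / 2)"
  have [measurable]: "S c u v \<in> borel \<rightarrow>\<^sub>M borel" for c u v
    unfolding S_def[abs_def] by measurable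
  have shear: "distr lborel borel (S c u v) = lborel" "distr lborel borel (S c v u) = lborel" for c
    unfolding S_def[abs_def] using assms by (auto intro!: lborel_distr_shear)
  have sin: "sin \<theta> = 2 * sin (\<theta> / 2) * cos (\<theta> / 2)" and cos: "cos \<theta> = 1 - 2 * (sin (\<theta> / 2))\<^sup>2"
    using sin_double[of "\<theta> / 2"] cos_double_sin[of "\<theta> / 2"] by simp_all
  have t: "t * cos (\<theta> / 2) = - sin (\<theta> / 2)"
    using \<theta> by (simp add: t_def tan_def)
  have 1: "1 + sin \<theta> * t = cos \<theta>"
    unfolding sin cos using t by algebra
  have 2: "t + t * cos \<theta> = - sin \<theta>"
    unfolding sin cos using t sin_cos_squared_add[of "\<theta> / 2"] by algebra
  have "plane_rotation u v \<theta> x = S t v u (S (sin \<theta>) u v (S t v u x))" for x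
  proof -
    have "S t v u (S (sin \<theta>) u v (S t v u x)) = 
       x + (t * (x \<bullet> v) + t * ((1 + sin \<theta> * t) * (x \<bullet> v) + sin \<theta> * (x \<bullet> u))) *\<^sub>R u
         + (sin \<theta> * (x \<bullet> u + t * (x \<bullet> v))) *\<^sub>R v"
      using assms by (simp add: S_def inner_simps inner_Basis algebra_simps flip: scaleR_add_left)
    also have "t * (x \<bullet> v) + t * ((1 + sin \<theta> * t) * (x \<bullet> v) + sin \<theta> * (x \<bullet> u)) =
        (cos \<theta> - 1) * (x \<bullet> u) - sin \<theta> * (x \<bullet> v)"
    proof -
      have "t * (x \<bullet> v) + t * ((1 + sin \<theta> * t) * (x \<bullet> v) + sin \<theta> * (x \<bullet> u)) =
          (t + t * cos \<theta>) * (x \<bullet> v) + ((1 + sin \<theta> * t) - 1) * (x \<bullet> u)"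
        unfolding 1 by (simp add: algebra_simps flip: 1)
      then show ?thesis unfolding 1 2 by simp
    qed
    also have "sin \<theta> * (x \<bullet> u + t * (x \<bullet> v)) = (cos \<theta> - 1) * (x \<bullet> v) + sin \<theta> * (x \<bullet> u)"
    proof -
      have "sin \<theta> * (x \<bullet> u + t * (x \<bullet> v)) = ((1 + sin \<theta> * t) - 1) * (x \<bullet> v) + sin \<theta> * (x \<bullet> u)"
        by (simp add: algebra_simps)
      then show ?thesis unfolding 1 .
    qed
    finally show ?thesis by (simp add: plane_rotation_def algebra_simps)
  qed
  then have "plane_rotation u v \<theta> = S t v u \<circ> (S (sin \<theta>) u v \<circ> S t v u)"
    by auto
  moreover have "distr lborel borel (f \<circ> g) = distr (distr lborel borel g) borel f"
    if "f \<in> borel \<rightarrow>\<^sub>M borel" "g \<in> borel \<rightarrow>\<^sub>M borel" for f g :: "'a \<Rightarrow> 'a"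
    using that by (simp add: distr_distr)
  ultimately show ?thesis
    by (simp add: shear measurable_comp)
qed

section \<open>Integration against the surface measure\<close>

lemma space_sphere_measure [simp]: "space sphere_measure = sphere 0 1"
  by (simp add: sphere_measure_def space_restrict_space)

lemma sets_sphere_measure [simp, measurable_cong]:
  "sets sphere_measure = sets (restrict_space borel (sphere 0 1))"
  by (simp add: sphere_measure_def)

lemma finite_measure_sphere_measure: "finite_measure (sphere_measure :: 'a::euclidean_space measure)"
proof
  have "DIM('a) = (DIM('a) - 1) + 1" using DIM_positive[where 'a='a] by linarith
  from emeasure_sphere_measure[OF this]
  show "emeasure (sphere_measure :: 'a measure) (space sphere_measure) \<noteq> \<infinity>"
    by simp
qed

lemma integrable_sphere_measure:
  fixes f :: "'a::euclidean_space \<Rightarrow> real"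
  assumes "continuous_on (sphere 0 1) f"
  shows "integrable sphere_measure f"
proof -
  interpret finite_measure "sphere_measure :: 'a measure" by (rule finite_measure_sphere_measure)
  have "bounded (f ` sphere 0 1)"
    using assms by (intro compact_imp_bounded compact_continuous_image) auto
  then obtain B where "\<And>x. x \<in> sphere 0 1 \<Longrightarrow> norm (f x) \<le> B"
    unfolding bounded_iff by blast
  then show ?thesis
    by (intro integrable_const_bound[where B = B])
      (auto intro!: AE_I2 borel_measurable_continuous_on_restrict assms
        simp: measurable_cong_sets[OF sets_sphere_measure refl])
qed

text \<open>Invariance passes from Lebesgue measure to the sphere through cones: the rotation
  preserves norms and commutes with scaling, so the cone over a preimage is the preimage of the
  cone.\<close>

lemma integral_sphere_measure_plane_rotation:
  fixes f :: "'a::euclidean_space \<Rightarrow> real"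
  assumes uv: "u \<in> Basis" "v \<in> Basis" "u \<noteq> v" and "cos (\<theta> / 2) \<noteq> 0"
    and f: "continuous_on (sphere 0 1) f"
  shows "(\<integral>x. f (plane_rotation u v \<theta> x) \<partial>sphere_measure) = (\<integral>x. f x \<partial>sphere_measure)"
proof -
  let ?R = "plane_rotation u v \<theta>" and ?S = "restrict_space borel (sphere 0 1) :: 'a measure"
  have R: "?R \<in> sphere_measure \<rightarrow>\<^sub>M ?S"
    unfolding measurable_cong_sets[OF sets_sphere_measure refl]
    by (rule measurable_restrict_space3) (auto simp: norm_plane_rotation uv)
  have "distr sphere_measure ?S ?R = sphere_measure"
  proof (rule measure_eqI)
    fix A assume "A \<in> sets (distr sphere_measure ?S ?R)"
    then have A: "A \<in> sets ?S" by simp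
    then have A': "A \<in> sets borel" "A \<subseteq> sphere 0 1"
      by (auto simp: sets_restrict_space)
    have RA: "?R -` A \<in> sets borel"
      using measurable_sets[OF plane_rotation_measurable A'(1), of u v \<theta>] by simp
    have [measurable]: "sgn \<in> borel_measurable (borel :: 'a measure)"
      unfolding sgn_div_norm by measurable
    have cone: "{x \<in> ball 0 1 - {0}. sgn x \<in> A} \<in> sets borel"
      using A'(1) by measurable
    have "emeasure (distr sphere_measure ?S ?R) A = emeasure sphere_measure (?R -` A \<inter> sphere 0 1)"
      using emeasure_distr[OF R A] by simp
    also have "?R -` A \<inter> sphere 0 1 = ?R -` A"
      using A'(2) by (force simp: norm_plane_rotation uv)
    also have "emeasure sphere_measure (?R -` A) =
        of_nat DIM('a) * emeasure lborel {x \<in> ball 0 1 - {0}. sgn x \<in> ?R -` A}"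
      using A'(2) RA by (intro emeasure_sphere_measure_eq_cone) (auto simp: norm_plane_rotation uv)
    also have "{x \<in> ball 0 1 - {0}. sgn x \<in> ?R -` A} = ?R -` {x \<in> ball 0 1 - {0}. sgn x \<in> A} \<inter> space lborel"
      using norm_plane_rotation[OF uv, of \<theta>]
      by (auto simp: sgn_div_norm plane_rotation_scaleR) (metis norm_eq_zero)+
    also have "emeasure lborel \<dots> = emeasure (distr lborel borel ?R) {x \<in> ball 0 1 - {0}. sgn x \<in> A}"
      using cone by (intro emeasure_distr[symmetric]) auto
    also have "of_nat DIM('a) * \<dots> = emeasure sphere_measure A"
      using emeasure_sphere_measure_eq_cone[OF A'] by (simp add: lborel_distr_plane_rotation assms)
    finally show "emeasure (distr sphere_measure ?S ?R) A = emeasure sphere_measure A" .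
  qed simp
  then show ?thesis
    using integral_distr[OF R, of f] f by (simp add: borel_measurable_continuous_on_restrict)
qed

section \<open>Integration by parts on the sphere\<close>

context
  fixes F :: "'a::euclidean_space \<Rightarrow> real" and F' :: "'a \<Rightarrow> 'a \<Rightarrow> real"
  assumes deriv: "\<And>x. (F has_derivative F' x) (at x)"
    and cont: "\<And>b. b \<in> Basis \<Longrightarrow> continuous_on UNIV (\<lambda>x. F' x b)"
begin

lemma F_continuous: "continuous_on A F"
  using deriv by (meson has_derivative_continuous continuous_at_imp_continuous_on)

lemma F'_expand: "F' x h = (\<Sum>b\<in>Basis. (h \<bullet> b) * F' x b)"
proof -
  interpret linear "F' x" using deriv by (rule has_derivative_linear)
  show ?thesis
    by (subst (1) euclidean_representation[of h, symmetric]) (simp add: sum scale)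
qed

lemma F'_continuous:
  assumes "continuous_on A h"
  shows "continuous_on A (\<lambda>x. F' x (h x))"
  unfolding F'_expand[of _ "h _"]
  by (intro continuous_intros assms continuous_on_subset[OF cont]) auto

text \<open>This is the derivative at angle 0 of the integral of F composed with a rotation, which
  is constant for small angles by invariance.\<close>

lemma integral_sphere_rotation_derivative_Basis:
  assumes uv: "u \<in> Basis" "v \<in> Basis"
  shows "(\<integral>x. (x \<bullet> u) * F' x v - (x \<bullet> v) * F' x u \<partial>sphere_measure) = 0"
proof (cases "u = v")
  case False
  let ?R = "plane_rotation u v"
  \<comment> \<open>Derivative of F along the velocity field of the rotation; the angular derivative
    at any angle is H at the rotated point.\<close>
  define H where "H x = F' x ((x \<bullet> u) *\<^sub>R v - (x \<bullet> v) *\<^sub>R u)" for x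
  have H: "H x = (x \<bullet> u) * F' x v - (x \<bullet> v) * F' x u" for x
  proof -
    interpret linear "F' x" using deriv by (rule has_derivative_linear)
    show ?thesis by (simp add: H_def diff scale)
  qed
  have H_cont: "continuous_on A H" for A
    unfolding H_def[abs_def] by (intro F'_continuous continuous_intros)
  have FR: "((\<lambda>\<theta>. F (?R \<theta> x)) has_real_derivative H (?R \<theta> x)) (at \<theta>)" for x \<theta>
  proof -
    have "((\<lambda>\<theta>. ?R \<theta> x) has_vector_derivative
        ((?R \<theta> x \<bullet> u) *\<^sub>R v - (?R \<theta> x \<bullet> v) *\<^sub>R u)) (at \<theta>)"
      unfolding plane_rotation_inner[OF uv False] unfolding plane_rotation_def
      by (auto intro!: derivative_eq_intros simp: algebra_simps)
    from vector_derivative_diff_chain_within[OF this has_derivative_at_withinI[OF deriv]]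
    show ?thesis
      by (simp add: o_def H_def has_real_derivative_iff_has_vector_derivative)
  qed
  \<comment> \<open>Rotated points stay on the sphere, so by the mean value theorem this single
    bound dominates every difference quotient.\<close>
  have "bounded (H ` sphere 0 1)"
    by (intro compact_imp_bounded compact_continuous_image H_cont) auto
  then obtain M where M: "\<And>x. x \<in> sphere 0 1 \<Longrightarrow> norm (H x) \<le> M"
    unfolding bounded_iff by blast
  define h where "h k x = (F (?R (1 / real (Suc k)) x) - F x) / (1 / real (Suc k))" for k :: nat and x
  have R_cont: "continuous_on A (?R \<theta>)" for A \<theta>
    unfolding plane_rotation_def[abs_def] by (intro continuous_intros)
  have FR_cont: "continuous_on A (\<lambda>x. F (?R \<theta> x))" for A \<theta>
    by (rule continuous_on_compose2[OF F_continuous R_cont subset_UNIV])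
  have h_cont: "continuous_on A (h k)" for A k
    unfolding h_def[abs_def] by (intro continuous_intros FR_cont F_continuous) auto
  have "(\<lambda>k. \<integral>x. h k x \<partial>sphere_measure) \<longlonglongrightarrow> (\<integral>x. H x \<partial>sphere_measure)"
  proof (rule integral_dominated_convergence[where w = "\<lambda>_. M"])
    show "AE x in sphere_measure. (\<lambda>k. h k x) \<longlonglongrightarrow> H x"
    proof (rule AE_I2)
      fix x
      have "((\<lambda>\<theta>. (F (?R \<theta> x) - F x) / \<theta>) \<longlongrightarrow> H x) (at 0)"
        using FR[of x 0] by (simp add: has_field_derivative_iff)
      moreover have "filterlim (\<lambda>k. 1 / real (Suc k)) (at 0) sequentially"
        unfolding filterlim_at using LIMSEQ_inverse_real_of_nat by (auto simp: inverse_eq_divide)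
      ultimately show "(\<lambda>k. h k x) \<longlonglongrightarrow> H x"
        unfolding h_def by (rule filterlim_compose)
    qed
    show "AE x in sphere_measure. norm (h k x) \<le> M" for k
    proof (rule AE_I2)
      fix x :: 'a assume x: "x \<in> space sphere_measure"
      obtain \<xi> where "F (?R (1 / real (Suc k)) x) - F (?R 0 x) = (1 / real (Suc k) - 0) * H (?R \<xi> x)"
        using MVT2[of 0 "1 / real (Suc k)" "\<lambda>\<theta>. F (?R \<theta> x)" "\<lambda>\<theta>. H (?R \<theta> x)"] FR
        by (auto simp del: of_nat_Suc)
      then have "h k x = H (?R \<xi> x)"
        by (simp add: h_def)
      then show "norm (h k x) \<le> M"
        using M[of "?R \<xi> x"] x by (simp add: norm_plane_rotation uv False)
    qed
  qed (auto intro!: borel_measurable_integrable integrable_sphere_measure H_cont h_cont)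
  moreover have "(\<integral>x. h k x \<partial>sphere_measure) = 0" for k
  proof -
    \<comment> \<open>All angles used are at most 1, so the half-angle cosine is nonzero, as the
      invariance lemma requires.\<close>
    have cos_pos: "cos (e / 2) > 0" if "0 < e" "e \<le> 1" for e :: real
      using that pi_gt3 by (intro cos_gt_zero_pi) auto
    have "cos (1 / real (Suc k) / 2) > 0" by (rule cos_pos) simp_all
    then have "(\<integral>x. F (?R (1 / real (Suc k)) x) \<partial>sphere_measure) = (\<integral>x. F x \<partial>sphere_measure)"
      by (intro integral_sphere_measure_plane_rotation uv False F_continuous) auto
    moreover have "integrable sphere_measure (\<lambda>x. F (?R (1 / real (Suc k)) x))" "integrable sphere_measure F"
      by (auto intro!: integrable_sphere_measure F_continuous FR_cont)
    ultimately show ?thesis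
      unfolding h_def by (subst integral_divide_zero, subst Bochner_Integration.integral_diff) auto
  qed
  ultimately show ?thesis
    unfolding H[symmetric] by (simp add: LIMSEQ_const_iff)
qed simp

end

text \<open>The rotation identity for \<open>x \<mapsto> (x \<bullet> u) F(x)\<close>, summed over \<open>u \<in> Basis\<close>.\<close>

lemma integral_sphere_gradient_Basis:
  fixes F :: "'a::euclidean_space \<Rightarrow> real"
  assumes deriv: "\<And>x. (F has_derivative F' x) (at x)"
    and cont: "\<And>b. b \<in> Basis \<Longrightarrow> continuous_on UNIV (\<lambda>x. F' x b)"
    and v: "v \<in> Basis"
  shows "(\<integral>x. F' x v - (x \<bullet> v) * F' x x \<partial>sphere_measure) =
    (real DIM('a) - 1) * (\<integral>x. (x \<bullet> v) * F x \<partial>sphere_measure)"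
proof -
  note Fc = F_continuous[OF deriv cont] and F'c = F'_continuous[OF deriv cont]
  have F': "F' x h = (\<Sum>b\<in>Basis. (h \<bullet> b) * F' x b)" for x h
    by (rule F'_expand[OF deriv cont])
  \<comment> \<open>Integrand of the rotation identity for x -> (x . u) F(x), with the product rule
    carried out.\<close>
  define h where "h u x = (x \<bullet> u) * ((v \<bullet> u) * F x + (x \<bullet> u) * F' x v)
      - (x \<bullet> v) * ((u \<bullet> u) * F x + (x \<bullet> u) * F' x u)" for u x
  have h0: "(\<integral>x. h u x \<partial>sphere_measure) = 0" if u: "u \<in> Basis" for u
    unfolding h_def
  proof (rule integral_sphere_rotation_derivative_Basis[where F = "\<lambda>x. (x \<bullet> u) * F x"
        and F' = "\<lambda>x h. (h \<bullet> u) * F x + (x \<bullet> u) * F' x h", OF _ _ u v])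
    show "((\<lambda>x. x \<bullet> u * F x) has_derivative (\<lambda>h. h \<bullet> u * F x + x \<bullet> u * F' x h)) (at x)" for x
      by (auto intro!: derivative_eq_intros deriv)
    show "continuous_on UNIV (\<lambda>x. b \<bullet> u * F x + x \<bullet> u * F' x b)" if "b \<in> Basis" for b
      by (intro continuous_intros Fc cont that)
  qed
  have int: "integrable sphere_measure (h u)" if "u \<in> Basis" for u
    unfolding h_def[abs_def] by (intro integrable_sphere_measure continuous_intros Fc F'c)
  have sum: "(\<Sum>u\<in>Basis. h u x) = (F' x v - (x \<bullet> v) * F' x x) - (real DIM('a) - 1) * ((x \<bullet> v) * F x)"
    if "x \<in> sphere 0 1" for x
  proof -
    \<comment> \<open>The second sum is the squared norm of x. In the total below, (x . v) F(x)
      occurs once with a plus sign and \<open>DIM('a)\<close> times with a minus sign.\<close>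
    have 1: "(\<Sum>u\<in>Basis. (x \<bullet> u) * (v \<bullet> u)) = x \<bullet> v" "(\<Sum>u\<in>Basis. (x \<bullet> u) * (x \<bullet> u)) = 1"
      using that by (simp_all flip: euclidean_inner norm_eq_1)
    have "(\<Sum>u\<in>Basis. h u x) = (\<Sum>u\<in>Basis. (x \<bullet> u) * (v \<bullet> u) * F x + (x \<bullet> u) * (x \<bullet> u) * F' x v
      - (x \<bullet> v) * F x - (x \<bullet> v) * ((x \<bullet> u) * F' x u))"
      by (intro sum.cong) (auto simp: h_def algebra_simps inner_Basis)
    also have "\<dots> = (x \<bullet> v) * F x + F' x v - real DIM('a) * ((x \<bullet> v) * F x) - (x \<bullet> v) * F' x x"
      unfolding sum_subtractf sum.distrib sum_distrib_right[symmetric] sum_distrib_left[symmetric]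
        1 F'[of x x, symmetric]
      by simp
    finally show ?thesis by (simp add: algebra_simps)
  qed
  have "0 = (\<Sum>u\<in>Basis. (\<integral>x. h u x \<partial>sphere_measure))" by (simp add: h0)
  also have "\<dots> = (\<integral>x. (\<Sum>u\<in>Basis. h u x) \<partial>sphere_measure)"
    by (rule Bochner_Integration.integral_sum[symmetric]) (rule int)
  also have "\<dots> = (\<integral>x. (F' x v - (x \<bullet> v) * F' x x) - (real DIM('a) - 1) * ((x \<bullet> v) * F x) \<partial>sphere_measure)"
    by (intro Bochner_Integration.integral_cong) (auto simp: sum)
  also have "\<dots> = (\<integral>x. F' x v - (x \<bullet> v) * F' x x \<partial>sphere_measure)
      - (real DIM('a) - 1) * (\<integral>x. (x \<bullet> v) * F x \<partial>sphere_measure)"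
    by (subst Bochner_Integration.integral_diff)
      (auto intro!: integrable_sphere_measure continuous_intros Fc F'c)
  finally show ?thesis by simp
qed

text \<open>A divergence theorem: on the sphere the left integrand is the derivative of F along v -
  (x . v) x, the tangential part of \<open>v\<close>, and the factor on the right comes from the
  curvature. Both sides are linear in \<open>v\<close>, so the coordinate case suffices.\<close>

lemma integral_sphere_gradient:
  fixes F :: "'a::euclidean_space \<Rightarrow> real"
  assumes deriv: "\<And>x. (F has_derivative F' x) (at x)"
    and cont: "\<And>b. b \<in> Basis \<Longrightarrow> continuous_on UNIV (\<lambda>x. F' x b)"
  shows "(\<integral>x. F' x v - (x \<bullet> v) * F' x x \<partial>sphere_measure) =
    (real DIM('a) - 1) * (\<integral>x. (x \<bullet> v) * F x \<partial>sphere_measure)"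
proof -
  note Fc = F_continuous[OF deriv cont] and F'c = F'_continuous[OF deriv cont]
  have F': "F' x h = (\<Sum>b\<in>Basis. (h \<bullet> b) * F' x b)" for x h
    by (rule F'_expand[OF deriv cont])
  have v: "x \<bullet> v = (\<Sum>b\<in>Basis. (v \<bullet> b) * (x \<bullet> b))" for x
    by (subst euclidean_inner) (simp add: mult.commute)
  have "(\<integral>x. F' x v - (x \<bullet> v) * F' x x \<partial>sphere_measure) =
      (\<integral>x. (\<Sum>b\<in>Basis. (v \<bullet> b) * (F' x b - (x \<bullet> b) * F' x x)) \<partial>sphere_measure)"
  proof (intro Bochner_Integration.integral_cong refl)
    fix x
    have "(\<Sum>b\<in>Basis. (v \<bullet> b) * (F' x b - (x \<bullet> b) * F' x x)) =
        (\<Sum>b\<in>Basis. (v \<bullet> b) * F' x b) - (\<Sum>b\<in>Basis. (v \<bullet> b) * (x \<bullet> b)) * F' x x"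
      by (simp add: right_diff_distrib sum_subtractf sum_distrib_right mult.assoc)
    then show "F' x v - (x \<bullet> v) * F' x x = (\<Sum>b\<in>Basis. (v \<bullet> b) * (F' x b - (x \<bullet> b) * F' x x))"
      unfolding F'[of x v, symmetric] v[symmetric] by simp
  qed
  also have "\<dots> = (\<Sum>b\<in>Basis. (v \<bullet> b) * (\<integral>x. F' x b - (x \<bullet> b) * F' x x \<partial>sphere_measure))"
    by (subst Bochner_Integration.integral_sum)
      (auto intro!: integrable_sphere_measure continuous_intros Fc F'c)
  also have "\<dots> = (\<Sum>b\<in>Basis. (v \<bullet> b) * ((real DIM('a) - 1) * (\<integral>x. (x \<bullet> b) * F x \<partial>sphere_measure)))"
    by (intro sum.cong refl arg_cong2[where f = "(*)"] integral_sphere_gradient_Basis deriv cont)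
  also have "\<dots> = (real DIM('a) - 1) * (\<Sum>b\<in>Basis. (v \<bullet> b) * (\<integral>x. (x \<bullet> b) * F x \<partial>sphere_measure))"
    by (simp add: sum_distrib_left mult_ac)
  also have "(\<Sum>b\<in>Basis. (v \<bullet> b) * (\<integral>x. (x \<bullet> b) * F x \<partial>sphere_measure)) =
      (\<integral>x. (\<Sum>b\<in>Basis. (v \<bullet> b) * ((x \<bullet> b) * F x)) \<partial>sphere_measure)"
    by (subst Bochner_Integration.integral_sum)
      (auto intro!: integrable_sphere_measure continuous_intros Fc)
  also have "\<dots> = (\<integral>x. (x \<bullet> v) * F x \<partial>sphere_measure)"
    unfolding v by (simp add: sum_distrib_right mult.assoc)
  finally show ?thesis .
qed

section \<open>Green's formula for zonal polynomials and orthogonality of different degrees\<close>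

lemma has_derivative_poly_inner:
  "((\<lambda>x. poly p (x \<bullet> y)) has_derivative (\<lambda>h. poly (pderiv p) (x \<bullet> y) * (h \<bullet> y))) (at x)"
proof -
  have "((\<lambda>x. x \<bullet> y) has_derivative (\<lambda>h. h \<bullet> y)) (at x)"
    by (auto intro!: derivative_eq_intros)
  from DERIV_compose_FDERIV[where g = "\<lambda>x. x \<bullet> y", OF poly_DERIV this, of p]
  show ?thesis by (simp add: mult.commute)
qed

text \<open>Apply \<open>integral_sphere_gradient\<close> to \<open>F(x) = p'(x \<bullet> y) q(x \<bullet> z)\<close> in the direction \<open>y\<close>.\<close>

lemma integral_sphere_green:
  fixes y z :: "'a::euclidean_space"
  assumes y: "norm y = 1"
  defines "d \<equiv> real DIM('a) - 1"
  shows "(\<integral>x. ((1 - (x \<bullet> y)\<^sup>2) * poly (pderiv (pderiv p)) (x \<bullet> y) - d * (x \<bullet> y) * poly (pderiv p) (x \<bullet> y))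
      * poly q (x \<bullet> z) \<partial>sphere_measure) =
    - (\<integral>x. poly (pderiv p) (x \<bullet> y) * poly (pderiv q) (x \<bullet> z) * (y \<bullet> z - (x \<bullet> y) * (x \<bullet> z)) \<partial>sphere_measure)"
    (is "?L = - ?R")
proof -
  let ?F' = "\<lambda>x v. poly (pderiv p) (x \<bullet> y) * (poly (pderiv q) (x \<bullet> z) * (v \<bullet> z)) +
    poly (pderiv (pderiv p)) (x \<bullet> y) * (v \<bullet> y) * poly q (x \<bullet> z)"
  have yy: "y \<bullet> y = 1" using y by (simp add: norm_eq_1)
  have "(\<integral>x. ?F' x y - (x \<bullet> y) * ?F' x x \<partial>sphere_measure) =
    (real DIM('a) - 1) * (\<integral>x. (x \<bullet> y) * (poly (pderiv p) (x \<bullet> y) * poly q (x \<bullet> z)) \<partial>sphere_measure)"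
    by (rule integral_sphere_gradient)
      (intro has_derivative_mult has_derivative_poly_inner continuous_intros)+
  also have "\<dots> = (\<integral>x. d * ((x \<bullet> y) * (poly (pderiv p) (x \<bullet> y) * poly q (x \<bullet> z))) \<partial>sphere_measure)"
    by (simp add: d_def)
  finally have eq: "(\<integral>x. ?F' x y - (x \<bullet> y) * ?F' x x \<partial>sphere_measure) = \<dots>" .
  have "?L + ?R = (\<integral>x. (?F' x y - (x \<bullet> y) * ?F' x x) -
      d * ((x \<bullet> y) * (poly (pderiv p) (x \<bullet> y) * poly q (x \<bullet> z))) \<partial>sphere_measure)"
    by (subst Bochner_Integration.integral_add[symmetric])
      (auto intro!: Bochner_Integration.integral_cong integrable_sphere_measure continuous_intros
        simp: yy algebra_simps power2_eq_square)
  also have "\<dots> = 0"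
    by (subst Bochner_Integration.integral_diff)
      (auto intro!: integrable_sphere_measure continuous_intros simp: eq)
  finally show ?thesis by simp
qed

text \<open>The right-hand side of Green's formula is symmetric under exchanging the two factors
  with their poles, while the left-hand side carries the eigenvalue of the first factor. The
  eigenvalues j (j + 2 a) and k (k + 2 a) differ because a > 0. The poles \<open>y\<close> and
  \<open>z\<close> may be distinct, as \<open>integral_C_Y\<close> requires.\<close>

lemma integral_sphere_gegenbauer_orthogonal:
  fixes y z :: "'a::euclidean_space"
  assumes "DIM('a) \<ge> 3" and y: "norm y = 1" and z: "norm z = 1" and "j \<noteq> k"
  defines "a \<equiv> (real DIM('a) - 2) / 2"
  shows "(\<integral>x. poly (gegenbauer a j) (x \<bullet> y) * poly (gegenbauer a k) (x \<bullet> z) \<partial>sphere_measure) = 0"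
    (is "?I = 0")
proof -
  have d: "real DIM('a) - 1 = 2 * a + 1" and a: "a > 0"
    using assms(1) by (auto simp: a_def field_simps)
  define P where "P j k y z = (\<integral>x. poly (pderiv (gegenbauer a j)) (x \<bullet> y) * poly (pderiv (gegenbauer a k)) (x \<bullet> z)
      * (y \<bullet> z - (x \<bullet> y) * (x \<bullet> z)) \<partial>sphere_measure)" for j k and y z :: 'a
  have green: "real j * (real j + 2 * a) * (\<integral>x. poly (gegenbauer a j) (x \<bullet> y) * poly (gegenbauer a k) (x \<bullet> z) \<partial>sphere_measure)
      = P j k y z" if "norm y = 1" for j k and y z :: 'a
    using integral_sphere_green[OF that, of "gegenbauer a j" "gegenbauer a k" z]
    unfolding P_def d gegenbauer_ode by (simp add: mult.assoc)
  have "P j k y z = P k j z y"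
    unfolding P_def by (simp add: mult_ac inner_commute)
  moreover have "(\<integral>x. poly (gegenbauer a k) (x \<bullet> z) * poly (gegenbauer a j) (x \<bullet> y) \<partial>sphere_measure) = ?I"
    by (simp add: mult.commute)
  ultimately have "real j * (real j + 2 * a) * ?I = real k * (real k + 2 * a) * ?I"
    using green[OF y, of j k z] green[OF z, of k j y] by simp
  then have "(real j - real k) * (real j + real k + 2 * a) * ?I = 0"
    by (simp add: algebra_simps)
  moreover have "real j + real k + 2 * a > 0" using a by (intro add_nonneg_pos) auto
  ultimately show ?thesis using \<open>j \<noteq> k\<close> by auto
qed

section \<open>Reduction of zonal integrals to integrals over an interval\<close>

text \<open>With g = X^(k+1) the recursion ties the moment of order k + 2 to that of order k, and g
  = 1 makes the first moment vanish; together with \<open>L 1 = 0\<close> this kills all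
  moments.\<close>

lemma linear_functional_eq_0_moments:
  fixes L :: "real poly \<Rightarrow> real"
  assumes add: "\<And>p q. L (p + q) = L p + L q" and smult: "\<And>c p. L (smult c p) = c * L p"
    and "d > 0" and 1: "L 1 = 0"
    and rec: "\<And>g. L ([:1, 0, -1:] * pderiv g - smult d ([:0, 1:] * g)) = 0"
  shows "L p = 0"
proof -
  have monom: "L (monom 1 k) = 0" for k
  proof (induction k rule: induct_nat_012)
    case 0
    then show ?case using 1 by simp
  next
    case 1
    have "L (smult (- d) (monom 1 (Suc 0))) = 0"
      using rec[of 1] by (simp add: monom_altdef)
    then have "- d * L (monom 1 (Suc 0)) = 0" by (simp only: smult)
    then show ?case using \<open>d > 0\<close> by simp
  next
    case (ge2 k)
    have "[:1, 0, -1:] * pderiv (monom 1 (Suc k)) - smult d ([:0, 1:] * monom 1 (Suc k)) =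
        smult (real (Suc k)) (monom 1 k) + smult (- (real (Suc k) + d)) (monom 1 (Suc (Suc k)))"
      by (intro poly_ext)
        (simp add: pderiv_monom poly_monom algebra_simps power2_eq_square del: of_nat_Suc)
    with rec[of "monom 1 (Suc k)"] have "- (real (Suc k) + d) * L (monom 1 (Suc (Suc k))) = 0"
      by (simp only: add smult ge2.IH mult_zero_right add_0_left)
    then show ?case using \<open>d > 0\<close> by simp
  qed
  have "\<forall>k. L (p * monom 1 k) = 0"
  proof (induction p)
    case 0
    show ?case using smult[of 0 0] by simp
  next
    case (pCons b p)
    have "pCons b p * monom 1 k = smult b (monom 1 k) + p * monom 1 (Suc k)" for k
      by (intro poly_ext) (simp add: poly_monom algebra_simps)
    then show ?case using pCons.IH by (simp add: add smult monom)
  qed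
  from this[rule_format, of 0] show ?thesis by simp
qed

lemma measure_sphere_measure:
  assumes "DIM('a::euclidean_space) = d + 1"
  shows "measure sphere_measure (sphere 0 1 :: 'a set) = sphere_area d"
  using emeasure_sphere_measure[OF assms] by (simp add: measure_def sphere_area_def)

lemma sphere_area_pos: "sphere_area d > 0"
  by (auto simp: sphere_area_def intro!: divide_pos_pos)

lemma integrable_sphere_weight:
  "set_integrable lborel {-1..1} (\<lambda>t. poly p t * sqrt (1 - t\<^sup>2) ^ n)"
  by (rule borel_integrable_atLeastAtMost') (intro continuous_intros)

text \<open>
  Both sides satisfy the same recursion for their moments, by integration by parts; hence they agree as soon
  as they agree on constants, where the right-hand side is a Beta integral.
\<close>

lemma integral_sphere_zonal:
  fixes y :: "'a::euclidean_space"
  assumes dim: "DIM('a) = d + 1" and "d \<ge> 2" and y: "norm y = 1"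
  shows "(\<integral>x. poly p (x \<bullet> y) \<partial>sphere_measure) =
    sphere_area (d - 1) * (LBINT t:{-1..1}. poly p t * sqrt (1 - t\<^sup>2) ^ (d - 2))"
proof -
  let ?M = "\<lambda>p. \<integral>x. poly p (x \<bullet> y) \<partial>sphere_measure"
  let ?I = "\<lambda>p. LBINT t:{-1..1}. poly p t * sqrt (1 - t\<^sup>2) ^ (d - 2)"
  let ?r = "\<lambda>g. [:1, 0, -1:] * pderiv g - smult (real d) ([:0, 1:] * g)"
  \<comment> \<open>This is \<open>integral_sphere_gradient\<close> for x -> g(x . y) in the
    direction \<open>y\<close>.\<close>
  have M: "?M (?r g) = 0" for g
  proof -
    have "y \<bullet> y = 1" using y by (simp add: norm_eq_1)
    then have "(\<integral>x. poly ([:1, 0, -1:] * pderiv g) (x \<bullet> y) \<partial>sphere_measure) =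
        (\<integral>x. poly (pderiv g) (x \<bullet> y) * (y \<bullet> y) - (x \<bullet> y) * (poly (pderiv g) (x \<bullet> y) * (x \<bullet> y)) \<partial>sphere_measure)"
      by (simp add: algebra_simps)
    also have "\<dots> = (real DIM('a) - 1) * (\<integral>x. (x \<bullet> y) * poly g (x \<bullet> y) \<partial>sphere_measure)"
      by (rule integral_sphere_gradient) (intro has_derivative_poly_inner continuous_intros)+
    also have "\<dots> = (\<integral>x. poly (smult (real d) ([:0, 1:] * g)) (x \<bullet> y) \<partial>sphere_measure)"
      using dim by (simp add: mult.left_commute[of "_ \<bullet> y" "real d"])
    finally show ?thesis
      by (simp only: poly_diff)
        (subst Bochner_Integration.integral_diff, auto intro!: integrable_sphere_measure continuous_intros)
  qed
  have I: "?I (?r g) = 0" for g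
  proof -
    \<comment> \<open>The integrand is the derivative of (1 - t^2)^(d/2) g(t), which vanishes at
      both endpoints. The interior form of the fundamental theorem is used because the square root
      is not differentiable at the endpoints.\<close>
    have "((\<lambda>t. poly (?r g) t * sqrt (1 - t\<^sup>2) ^ (d - 2)) has_integral
        sqrt (1 - 1\<^sup>2) ^ d * poly g 1 - sqrt (1 - (-1)\<^sup>2) ^ d * poly g (-1)) {-1..1}"
    proof (rule fundamental_theorem_of_calculus_interior)
      show "continuous_on {-1..1} (\<lambda>t. sqrt (1 - t\<^sup>2) ^ d * poly g t)"
        by (intro continuous_intros)
      fix t :: real assume "t \<in> {-1<..<1}"
      then have t: "1 - t\<^sup>2 > 0" by (simp add: abs_square_less_1 abs_less_iff)
      obtain e where e: "d = Suc (Suc e)" using \<open>d \<ge> 2\<close> by (metis add_2_eq_Suc le_Suc_ex)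
      have sq: "sqrt (1 - t\<^sup>2) * sqrt (1 - t\<^sup>2) = 1 - t\<^sup>2" using t by simp
      have "((\<lambda>t. sqrt (1 - t\<^sup>2) ^ d * poly g t) has_real_derivative
          (real d * sqrt (1 - t\<^sup>2) ^ (d - 1) * (- t / sqrt (1 - t\<^sup>2))) * poly g t
          + sqrt (1 - t\<^sup>2) ^ d * poly (pderiv g) t) (at t)"
        using t by (auto intro!: derivative_eq_intros poly_DERIV simp: field_simps)
      also have "(real d * sqrt (1 - t\<^sup>2) ^ (d - 1) * (- t / sqrt (1 - t\<^sup>2))) * poly g t
          + sqrt (1 - t\<^sup>2) ^ d * poly (pderiv g) t = poly (?r g) t * sqrt (1 - t\<^sup>2) ^ (d - 2)"
      proof -
        have "sqrt (1 - t\<^sup>2) ^ d = (1 - t\<^sup>2) * sqrt (1 - t\<^sup>2) ^ e"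
          using sq by (simp add: e mult.assoc[symmetric])
        moreover have "real d * sqrt (1 - t\<^sup>2) ^ (d - 1) * (- t / sqrt (1 - t\<^sup>2)) =
            - real d * t * sqrt (1 - t\<^sup>2) ^ e"
          using t by (simp add: e) (simp add: algebra_simps)
        moreover have "d - 2 = e" by (simp add: e)
        ultimately show ?thesis
          by (simp only:) (simp add: algebra_simps power2_eq_square)
      qed
      finally show "((\<lambda>t. sqrt (1 - t\<^sup>2) ^ d * poly g t) has_vector_derivative
          poly (?r g) t * sqrt (1 - t\<^sup>2) ^ (d - 2)) (at t)"
        by (simp only: has_real_derivative_iff_has_vector_derivative)
    qed simp
    then have "integral {-1..1} (\<lambda>t. poly (?r g) t * sqrt (1 - t\<^sup>2) ^ (d - 2)) = 0"
      using \<open>d \<ge> 2\<close> by (auto dest!: integral_unique)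
    then show ?thesis
      by (subst set_borel_integral_eq_integral) (rule integrable_sphere_weight)
  qed
  \<comment> \<open>This Beta integral is the one behind the volume of the unit ball.\<close>
  have I1: "?I 1 = Beta (1 / 2) (real d / 2)"
  proof -
    have half: "real (d - 2) / 2 + 1 = real d / 2" using \<open>d \<ge> 2\<close> by (simp add: of_nat_diff field_simps)
    have "(\<integral>\<^sup>+t. ennreal (indicator {-1..1} t * sqrt (1 - t\<^sup>2) ^ (d - 2)) \<partial>lborel) = ennreal (Beta (1 / 2) (real d / 2))"
      using emeasure_cball_aux_integral[of "d - 2"] unfolding half by simp
    moreover have "Beta (1 / 2) (real d / 2) \<ge> 0"
      using \<open>d \<ge> 2\<close> by (auto simp: Beta_def intro!: divide_nonneg_nonneg mult_nonneg_nonneg Gamma_real_nonneg)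
    ultimately have "(\<integral>t. indicator {-1..1} t * sqrt (1 - t\<^sup>2) ^ (d - 2) \<partial>lborel) = Beta (1 / 2) (real d / 2)"
      by (intro integral_eq_nn_integral[THEN trans])
        (auto intro!: AE_I2 simp: indicator_def power_le_one abs_square_le_1 abs_le_iff)
    then show ?thesis by (simp add: set_lebesgue_integral_def)
  qed
  have area: "sphere_area (d - 1) * Beta (1 / 2) (real d / 2) = sphere_area d"
  proof -
    have "Gamma (real d / 2) \<noteq> 0"
      using \<open>d \<ge> 2\<close> by (intro order.strict_implies_not_eq[symmetric] Gamma_real_pos) auto
    moreover have "pi powr ((real d + 1) / 2) = pi powr (real d / 2) * sqrt pi"
      by (simp add: add_divide_distrib powr_add powr_half_sqrt)
    moreover have half: "1 / 2 + real d / 2 = (real d + 1) / 2"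
      by (simp add: add_divide_distrib)
    moreover have "real (d - 1) + 1 = real d" using \<open>d \<ge> 2\<close> by simp
    ultimately show ?thesis
      unfolding sphere_area_def Beta_def
      by (simp only: half Gamma_one_half_real) simp
  qed
  have "?M p - sphere_area (d - 1) * ?I p = 0"
  proof (rule linear_functional_eq_0_moments[where d = "real d" and L = "\<lambda>p. ?M p - sphere_area (d - 1) * ?I p"])
    have ir: "integrable sphere_measure (\<lambda>x. poly p (x \<bullet> y))" for p
      by (intro integrable_sphere_measure continuous_intros)
    have "?M (p + q) = ?M p + ?M q" for p q
      by (simp add: ir)
    moreover have "?I (p + q) = ?I p + ?I q" for p q
      using set_integral_add(2)[OF integrable_sphere_weight integrable_sphere_weight, of p "d - 2" q "d - 2"]
      by (simp add: distrib_right)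
    ultimately show "?M (p + q) - sphere_area (d - 1) * ?I (p + q) =
      ?M p - sphere_area (d - 1) * ?I p + (?M q - sphere_area (d - 1) * ?I q)" for p q
      by (simp add: algebra_simps)
    show "?M (smult c p) - sphere_area (d - 1) * ?I (smult c p) = c * (?M p - sphere_area (d - 1) * ?I p)" for c p
      by (simp add: algebra_simps)
    show "?M 1 - sphere_area (d - 1) * ?I 1 = 0"
      using I1 area measure_sphere_measure[OF dim] by simp
    show "?M (?r g) - sphere_area (d - 1) * ?I (?r g) = 0" for g
      unfolding M I by simp
  qed (use \<open>d \<ge> 2\<close> in simp)
  then show ?thesis by simp
qed

section \<open>Zonal eigenfunctions\<close>

lemma frechet_derivative_eqI: "(f has_derivative f') (at x) \<Longrightarrow> frechet_derivative f (at x) = f'"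
  using frechet_derivative_at by metis

lemma Ck_on_cong:
  assumes "open U" "\<And>x. x \<in> U \<Longrightarrow> f x = g x" "Ck_on k U f"
  shows "Ck_on k U g"
  using assms(2,3)
proof (induction k arbitrary: f g)
  case 0
  have "continuous_on U f" using 0(2) by simp
  then have "continuous_on U g" by (rule continuous_on_eq) (rule 0(1))
  then show ?case by simp
next
  case (Suc k)
  have D: "(g has_derivative frechet_derivative f (at x)) (at x)" if "x \<in> U" for x
  proof (rule has_derivative_transform_within_open[OF _ \<open>open U\<close> that])
    have "f differentiable (at x)" using Suc.prems(2) that by simp
    then show "(f has_derivative frechet_derivative f (at x)) (at x)"
      by (simp only: frechet_derivative_works)
  qed (rule Suc.prems(1))
  have "Ck_on k U (\<lambda>x. frechet_derivative g (at x) b)" if b: "b \<in> Basis" for b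
  proof (rule Suc.IH)
    show "Ck_on k U (\<lambda>x. frechet_derivative f (at x) b)" using Suc.prems(2) b by simp
    show "frechet_derivative f (at x) b = frechet_derivative g (at x) b" if "x \<in> U" for x
      using frechet_derivative_eqI[OF D[OF that]] by simp
  qed
  moreover have "g differentiable (at x)" if "x \<in> U" for x
    using D[OF that] by (rule differentiableI)
  ultimately show ?case by simp
qed

text \<open>Lets explicit derivative formulas replace \<open>frechet_derivative\<close>. The two
  agree on \<open>U\<close>, and openness makes that enough for the higher derivatives.\<close>

lemma Ck_on_SucI:
  assumes "open U" "\<And>x. x \<in> U \<Longrightarrow> (f has_derivative f' x) (at x)"
    and "\<And>b. b \<in> Basis \<Longrightarrow> Ck_on k U (\<lambda>x. f' x b)"
  shows "Ck_on (Suc k) U f"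
proof -
  have "Ck_on k U (\<lambda>x. frechet_derivative f (at x) b)" if b: "b \<in> Basis" for b
  proof (rule Ck_on_cong[OF assms(1) _ assms(3)[OF b]])
    show "f' x b = frechet_derivative f (at x) b" if "x \<in> U" for x
      using frechet_derivative_eqI[OF assms(2)[OF that]] by simp
  qed
  moreover have "f differentiable (at x)" if "x \<in> U" for x
    using assms(2)[OF that] by (rule differentiableI)
  ultimately show ?thesis by simp
qed

text \<open>Serves the product rule, where one factor of each term stays undifferentiated.\<close>

lemma Ck_on_SucD: "Ck_on (Suc k) U f \<Longrightarrow> Ck_on k U f"
proof (induction k arbitrary: f)
  case 0
  then have "\<forall>x\<in>U. f differentiable (at x)" by simp
  then have "continuous_on U f"
    by (intro continuous_at_imp_continuous_on ballI differentiable_imp_continuous_within) blast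
  then show ?case by simp
next
  case (Suc k)
  have diff: "f differentiable (at x)" if "x \<in> U" for x
    using Suc.prems that unfolding Ck_on.simps(2)[of "Suc k"] by blast
  have "Ck_on (Suc k) U (\<lambda>x. frechet_derivative f (at x) b)" if "b \<in> Basis" for b
    using Suc.prems that unfolding Ck_on.simps(2)[of "Suc k" U f] by blast
  then have "Ck_on k U (\<lambda>x. frechet_derivative f (at x) b)" if "b \<in> Basis" for b
    using that by (intro Suc.IH)
  then show ?case using diff by simp
qed

lemma Ck_on_Suc_has_derivative:
  "Ck_on (Suc k) U f \<Longrightarrow> x \<in> U \<Longrightarrow> (f has_derivative frechet_derivative f (at x)) (at x)"
  by (simp add: frechet_derivative_works[symmetric])

lemma Ck_on_const: "open U \<Longrightarrow> Ck_on k U (\<lambda>x. c)"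
proof (induction k arbitrary: c)
  case (Suc k)
  show ?case
    by (rule Ck_on_SucI[OF Suc.prems has_derivative_const]) (rule Suc.IH[OF Suc.prems])
qed simp

lemma Ck_on_inner: "open U \<Longrightarrow> Ck_on k U (\<lambda>x. x \<bullet> y)"
proof (cases k)
  case (Suc m)
  assume "open U"
  then show ?thesis unfolding Suc
    by (intro Ck_on_SucI[OF _ bounded_linear_imp_has_derivative[OF bounded_linear_inner_left]] Ck_on_const)
qed (auto intro!: continuous_intros)

lemma Ck_on_add:
  assumes U: "open U"
  shows "Ck_on k U f \<Longrightarrow> Ck_on k U g \<Longrightarrow> Ck_on k U (\<lambda>x. f x + g x)"
proof (induction k arbitrary: f g)
  case (Suc k)
  note D = Ck_on_Suc_has_derivative[OF Suc.prems(1)] Ck_on_Suc_has_derivative[OF Suc.prems(2)]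
  show ?case
    using Suc.prems by (intro Ck_on_SucI[OF U has_derivative_add[OF D]] Suc.IH) simp_all
qed (auto intro!: continuous_intros)

lemma Ck_on_mult:
  assumes U: "open U"
  shows "Ck_on k U f \<Longrightarrow> Ck_on k U g \<Longrightarrow> Ck_on k U (\<lambda>x. f x * g x)"
proof (induction k arbitrary: f g)
  case (Suc k)
  note D = Ck_on_Suc_has_derivative[OF Suc.prems(1)] Ck_on_Suc_has_derivative[OF Suc.prems(2)]
  show ?case
    using Suc.prems Ck_on_SucD[OF Suc.prems(1)] Ck_on_SucD[OF Suc.prems(2)]
    by (intro Ck_on_SucI[OF U has_derivative_mult[OF D]] Ck_on_add[OF U] Suc.IH) simp_all
qed (auto intro!: continuous_intros)

lemma Ck_on_minus: "open U \<Longrightarrow> Ck_on k U f \<Longrightarrow> Ck_on k U (\<lambda>x. - f x)"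
  using Ck_on_mult[OF _ Ck_on_const[of U k "- 1"], of f] by simp

lemma Ck_on_poly: "open U \<Longrightarrow> Ck_on k U f \<Longrightarrow> Ck_on k U (\<lambda>x. poly p (f x))"
  by (induction p) (auto intro!: Ck_on_add Ck_on_mult Ck_on_const)

text \<open>The cube of the inverse norm is spelled out as a product so that the closure rules for
  C^k functions apply to it.\<close>

lemma has_derivative_inverse_norm:
  fixes x :: "'a::euclidean_space"
  assumes "x \<noteq> 0"
  shows "((\<lambda>x. inverse (norm x)) has_derivative
    (\<lambda>h. - (x \<bullet> h) * (inverse (norm x) * (inverse (norm x) * inverse (norm x))))) (at x)"
  by (rule has_derivative_eq_rhs[OF Deriv.has_derivative_inverse[OF _ has_derivative_norm[OF assms]]])
    (use assms in \<open>auto simp: fun_eq_iff sgn_div_norm inner_commute\<close>)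

text \<open>The derivative is again built from coordinates and inverse norms by products and a sign,
  so the induction on the order closes up.\<close>

lemma Ck_on_inverse_norm: "Ck_on k (- {0}) (\<lambda>x::'a::euclidean_space. inverse (norm x))"
proof (induction k)
  case 0
  show ?case by (auto intro!: continuous_intros)
next
  case (Suc k)
  have U: "open (- {0 :: 'a})" by auto
  show ?case
    by (rule Ck_on_SucI[OF U has_derivative_inverse_norm], simp)
      (intro Ck_on_mult Ck_on_minus Ck_on_inner U Suc.IH)
qed

section \<open>Smoothness and Laplace-Beltrami operator of zonal functions\<close>

lemma sgn_inner: "sgn x \<bullet> y = inverse (norm x) * (x \<bullet> y)"
  by (simp add: sgn_div_norm)

lemma smooth_on_sphere_zonal: "smooth_on_sphere (\<lambda>x. poly p (x \<bullet> y))"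
  unfolding smooth_on_sphere_def sgn_inner
  by (intro allI Ck_on_poly Ck_on_mult Ck_on_inverse_norm Ck_on_inner) auto

text \<open>The second derivatives of x -> p((x . y) / |x|) are computed at a unit vector and summed
  over the coordinate directions.\<close>

lemma laplace_beltrami_zonal:
  fixes x y :: "'a::euclidean_space"
  assumes x: "norm x = 1" and y: "norm y = 1"
  shows "laplace_beltrami (\<lambda>x. poly p (x \<bullet> y)) x =
    (1 - (x \<bullet> y)\<^sup>2) * poly (pderiv (pderiv p)) (x \<bullet> y) - (real DIM('a) - 1) * (x \<bullet> y) * poly (pderiv p) (x \<bullet> y)"
proof -
  define i where "i w = inverse (norm w)" for w :: 'a
  \<comment> \<open>Derivative of (w . y) / |w| in the direction b.\<close>
  define D where "D w b = i w * (b \<bullet> y) + - (w \<bullet> b) * (i w * (i w * i w)) * (w \<bullet> y)" for w b :: 'a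
  note i' = has_derivative_inverse_norm[where 'a = 'a, folded i_def]
  have 1: "((\<lambda>w. poly q (sgn w \<bullet> y)) has_derivative (\<lambda>h. poly (pderiv q) (sgn w \<bullet> y) * D w h)) (at w)"
    if "w \<noteq> 0" for q and w :: 'a
  proof -
    have "((\<lambda>w. i w * (w \<bullet> y)) has_derivative D w) (at w)"
      unfolding D_def[abs_def]
      by (rule has_derivative_mult[OF i'[OF that]]) (auto intro!: derivative_eq_intros)
    from DERIV_compose_FDERIV[OF poly_DERIV this, of q]
    show ?thesis unfolding sgn_inner i_def[symmetric] by (simp add: mult.commute)
  qed
  have 2: "frechet_derivative (\<lambda>w. frechet_derivative (\<lambda>w. poly p (sgn w \<bullet> y)) (at w) b) (at x) b =
      poly (pderiv (pderiv p)) (x \<bullet> y) * (b \<bullet> y - (x \<bullet> b) * (x \<bullet> y))\<^sup>2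
      + poly (pderiv p) (x \<bullet> y) * (3 * (x \<bullet> b) * (x \<bullet> b) * (x \<bullet> y) - 2 * (x \<bullet> b) * (b \<bullet> y) - x \<bullet> y)"
    if b: "b \<in> Basis" for b
  proof -
    have x0: "x \<noteq> 0" using x by auto
    have ix: "i x = 1" and sx: "sgn x = x" using x by (simp_all add: i_def sgn_div_norm)
    have D': "((\<lambda>w. D w b) has_derivative
       (\<lambda>h. - (x \<bullet> h) * (b \<bullet> y) + (- (h \<bullet> b) * (x \<bullet> y) + 3 * (x \<bullet> b) * (x \<bullet> h) * (x \<bullet> y) - (x \<bullet> b) * (h \<bullet> y)))) (at x)"
    proof -
      have i1: "(i has_derivative (\<lambda>h. - (x \<bullet> h))) (at x)"
        using i'[OF x0] by (simp add: ix)
      have inner: "((\<lambda>w. w \<bullet> c) has_derivative (\<lambda>h. h \<bullet> c)) (at x)" for c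
        by (auto intro!: derivative_eq_intros)
      have i3: "((\<lambda>w. i w * (i w * i w)) has_derivative (\<lambda>h. - 3 * (x \<bullet> h))) (at x)"
        by (rule has_derivative_eq_rhs[OF has_derivative_mult[OF i1 has_derivative_mult[OF i1 i1]]])
          (simp add: ix fun_eq_iff)
      show ?thesis
        unfolding D_def
        by (rule has_derivative_eq_rhs[OF has_derivative_add[OF has_derivative_mult_left[OF i1]
                has_derivative_mult[OF has_derivative_mult[OF has_derivative_minus[OF inner] i3] inner]]])
          (simp add: ix fun_eq_iff algebra_simps)
    qed
    have "((\<lambda>w. poly (pderiv p) (sgn w \<bullet> y) * D w b) has_derivative
       (\<lambda>h. poly (pderiv p) (sgn x \<bullet> y) * (- (x \<bullet> h) * (b \<bullet> y) + (- (h \<bullet> b) * (x \<bullet> y) + 3 * (x \<bullet> b) * (x \<bullet> h) * (x \<bullet> y) - (x \<bullet> b) * (h \<bullet> y)))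
         + poly (pderiv (pderiv p)) (sgn x \<bullet> y) * D x h * D x b)) (at x)"
      by (rule has_derivative_mult[OF 1[OF x0] D'])
    \<comment> \<open>The formula for the first derivative holds away from the origin, on an open
      set containing x, so it may be differentiated once more at x.\<close>
    moreover have "poly (pderiv p) (sgn w \<bullet> y) * D w b = frechet_derivative (\<lambda>w. poly p (sgn w \<bullet> y)) (at w) b"
      if "w \<in> - {0}" for w
      using frechet_derivative_eqI[OF 1, of w p] that by simp
    ultimately have "((\<lambda>w. frechet_derivative (\<lambda>w. poly p (sgn w \<bullet> y)) (at w) b) has_derivative
       (\<lambda>h. poly (pderiv p) (sgn x \<bullet> y) * (- (x \<bullet> h) * (b \<bullet> y) + (- (h \<bullet> b) * (x \<bullet> y) + 3 * (x \<bullet> b) * (x \<bullet> h) * (x \<bullet> y) - (x \<bullet> b) * (h \<bullet> y)))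
         + poly (pderiv (pderiv p)) (sgn x \<bullet> y) * D x h * D x b)) (at x)"
      using x0 by (elim has_derivative_transform_within_open[where s = "- {0}"]) auto
    from frechet_derivative_eqI[OF this] show ?thesis
      using b by (simp add: sx D_def ix algebra_simps power2_eq_square inner_Basis)
  qed
  have yy: "(\<Sum>b\<in>Basis. (b \<bullet> y)\<^sup>2) = 1" "(\<Sum>b\<in>Basis. (x \<bullet> b)\<^sup>2) = 1" "(\<Sum>b\<in>Basis. (x \<bullet> b) * (b \<bullet> y)) = x \<bullet> y"
    using x y by (simp_all add: norm_eq_1 euclidean_inner[of x x] euclidean_inner[of y y]
        euclidean_inner[of x y] power2_eq_square inner_commute)
  \<comment> \<open>Squared length of the component of \<open>y\<close> orthogonal to
    \<open>x\<close>.\<close>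
  have s: "(\<Sum>b\<in>Basis. (b \<bullet> y - (x \<bullet> b) * (x \<bullet> y))\<^sup>2) = 1 - (x \<bullet> y)\<^sup>2"
  proof -
    have "(\<Sum>b\<in>Basis. (b \<bullet> y - (x \<bullet> b) * (x \<bullet> y))\<^sup>2) =
      (\<Sum>b\<in>Basis. (b \<bullet> y)\<^sup>2) - 2 * (x \<bullet> y) * (\<Sum>b\<in>Basis. (x \<bullet> b) * (b \<bullet> y)) + (x \<bullet> y)\<^sup>2 * (\<Sum>b\<in>Basis. (x \<bullet> b)\<^sup>2)"
      by (simp add: sum_distrib_left sum_subtractf[symmetric] sum.distrib[symmetric])
        (simp add: algebra_simps power2_eq_square)
    then show ?thesis unfolding yy by (simp add: power2_eq_square)
  qed
  \<comment> \<open>Laplacian of (w . y) / |w| at \<open>x\<close>: restricted to the sphere, a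
    linear function has as eigenvalue minus the dimension of the sphere.\<close>
  have t: "(\<Sum>b\<in>Basis. 3 * (x \<bullet> b) * (x \<bullet> b) * (x \<bullet> y) - 2 * (x \<bullet> b) * (b \<bullet> y) - x \<bullet> y) = - (real DIM('a) - 1) * (x \<bullet> y)"
  proof -
    have "(\<Sum>b\<in>Basis. 3 * (x \<bullet> b) * (x \<bullet> b) * (x \<bullet> y) - 2 * (x \<bullet> b) * (b \<bullet> y) - x \<bullet> y) =
      3 * (x \<bullet> y) * (\<Sum>b\<in>Basis. (x \<bullet> b)\<^sup>2) - 2 * (\<Sum>b\<in>Basis. (x \<bullet> b) * (b \<bullet> y)) - real DIM('a) * (x \<bullet> y)"
      by (simp add: sum_distrib_left sum_subtractf)
        (simp add: algebra_simps power2_eq_square)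
    then show ?thesis unfolding yy by (simp add: algebra_simps)
  qed
  show ?thesis
    unfolding laplace_beltrami_def laplacian_def
    by (simp add: 2 sum.distrib sum_distrib_left[symmetric] s t) (simp add: algebra_simps)
qed

text \<open>For the parameter a = (d - 1) / 2 one has 2 a + 1 = d, so \<open>gegenbauer_ode\<close>
  matches the expression in \<open>laplace_beltrami_zonal\<close>.\<close>

lemma gegenbauer_zonal_eigenfunction:
  fixes y :: "'a::euclidean_space"
  assumes dim: "DIM('a) = d + 1" and y: "norm y = 1"
  shows "(\<lambda>x. poly (sphere_gegenbauer l d) (x \<bullet> y)) \<in> sphere_eigenspace (- (real l * (real l + real d - 1)))"
proof -
  define C where "C = gegenbauer ((real d - 1) / 2) l"
  define \<kappa> where "\<kappa> = 1 / poly C 1"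
  have G: "sphere_gegenbauer l d = smult \<kappa> C"
    by (simp add: sphere_gegenbauer_def Let_def C_def \<kappa>_def)
  have "2 * ((real d - 1) / 2) = real d - 1" by simp
  then have ode: "(1 - t\<^sup>2) * poly (pderiv (pderiv C)) t - real d * t * poly (pderiv C) t =
      - (real l * (real l + real d - 1)) * poly C t" for t
    using gegenbauer_ode[of t "(real d - 1) / 2" l] unfolding C_def by (simp only:) (simp add: add_diff_eq)
  have "laplace_beltrami (\<lambda>x. poly (sphere_gegenbauer l d) (x \<bullet> y)) x =
      - (real l * (real l + real d - 1)) * poly (sphere_gegenbauer l d) (x \<bullet> y)" if "norm x = 1" for x
  proof -
    have "laplace_beltrami (\<lambda>x. poly (sphere_gegenbauer l d) (x \<bullet> y)) x = \<kappa> *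
        ((1 - (x \<bullet> y)\<^sup>2) * poly (pderiv (pderiv C)) (x \<bullet> y) - real d * (x \<bullet> y) * poly (pderiv C) (x \<bullet> y))"
      unfolding laplace_beltrami_zonal[OF that y] G by (simp add: dim pderiv_smult algebra_simps)
    then show ?thesis unfolding ode by (simp add: G)
  qed
  then show ?thesis
    by (simp add: sphere_eigenspace_def smooth_on_sphere_zonal)
qed

section \<open>Addition theorem and Funk--Hecke formula\<close>

text \<open>Distributivity, by induction on r. This collapses the sum over m_1, ..., m_r, encoded as
  lists of length r, into a power of the kernel.\<close>

lemma sum_prod_list_power:
  fixes f :: "'b \<Rightarrow> 'c::comm_semiring_1"
  assumes "finite I"
  shows "(\<Sum>ms | length ms = r \<and> set ms \<subseteq> I. \<Prod>k\<leftarrow>ms. f k) = (\<Sum>k\<in>I. f k) ^ r"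
proof (induction r)
  case 0
  have "{ms. length ms = 0 \<and> set ms \<subseteq> I} = {[]}" by auto
  then show ?case by (simp only:) simp
next
  case (Suc r)
  let ?L = "{ms. length ms = r \<and> set ms \<subseteq> I}"
  have "{ms. length ms = Suc r \<and> set ms \<subseteq> I} = (\<lambda>(k, ms). k # ms) ` (I \<times> ?L)"
    by (auto simp: length_Suc_conv)
  then have "(\<Sum>ms | length ms = Suc r \<and> set ms \<subseteq> I. \<Prod>k\<leftarrow>ms. f k) =
      (\<Sum>(k, ms)\<in>I \<times> ?L. f k * (\<Prod>k\<leftarrow>ms. f k))"
    by (simp add: sum.reindex inj_on_def case_prod_unfold)
  also have "\<dots> = (\<Sum>k\<in>I. f k) ^ Suc r"
    by (simp add: sum.cartesian_product[symmetric] sum_product[symmetric] Suc.IH)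
  finally show ?case .
qed

lemma smooth_on_sphere_imp_continuous_on:
  assumes "smooth_on_sphere f"
  shows "continuous_on (sphere 0 1) f"
proof -
  have "continuous_on (- {0}) (\<lambda>x. f (sgn x))"
    using assms by (metis smooth_on_sphere_def Ck_on.simps(1))
  then have "continuous_on (sphere 0 1) (\<lambda>x. f (sgn x))"
    by (rule continuous_on_subset) auto
  then show ?thesis
    by (rule continuous_on_eq) (simp add: sgn_div_norm)
qed

lemma continuous_on_prod_list:
  fixes f :: "'b \<Rightarrow> 'a::topological_space \<Rightarrow> real"
  assumes "\<And>k. k \<in> set ks \<Longrightarrow> continuous_on S (f k)"
  shows "continuous_on S (\<lambda>x. \<Prod>k\<leftarrow>ks. f k x)"
  using assms by (induction ks) (auto intro!: continuous_intros)

section \<open>Expansion of the zonal function in a given eigenbasis\<close>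

locale sphere_harmonic_basis =
  fixes Y :: "nat \<Rightarrow> 'a::euclidean_space \<Rightarrow> real" and d l :: nat
  assumes dim: "DIM('a) = d + 1" and d: "d \<ge> 2" and l: "l \<ge> 1"
    and basis: "orthonormal_eigenbasis (- (real l * (real l + real d - 1))) {1..eigenspace_dim l d} Y"
begin

abbreviation "N \<equiv> eigenspace_dim l d"
abbreviation "I \<equiv> {1..N}"
abbreviation "S \<equiv> sphere 0 1 :: 'a set"
abbreviation "\<sigma> \<equiv> sphere_measure :: 'a measure"
abbreviation "G \<equiv> sphere_gegenbauer l d"
abbreviation "C \<equiv> gegenbauer ((real d - 1) / 2)"

text \<open>Coefficients of the zonal function with pole \<open>y\<close>. By
  \<open>AE_Y_eq_coeff\<close> they are, for almost every \<open>y\<close>, a fixed multiple of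
  \<open>Y m y\<close>.\<close>

definition coeff_Y :: "nat \<Rightarrow> 'a \<Rightarrow> real" where
  "coeff_Y m y = (\<integral>x. poly G (x \<bullet> y) * Y m x \<partial>\<sigma>)"

lemma continuous_Y: "m \<in> I \<Longrightarrow> continuous_on S (Y m)"
  using basis by (auto simp: orthonormal_eigenbasis_def sphere_eigenspace_def intro!: smooth_on_sphere_imp_continuous_on)

lemma integral_YY: "m \<in> I \<Longrightarrow> m' \<in> I \<Longrightarrow> (\<integral>x. Y m x * Y m' x \<partial>\<sigma>) = (if m = m' then 1 else 0)"
  using basis by (auto simp: orthonormal_eigenbasis_def)

lemma integral_sum_Y:
  assumes "m \<in> I"
  shows "(\<integral>x. (\<Sum>k\<in>I. b k * Y k x) * Y m x \<partial>\<sigma>) = b m"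
proof -
  have "(\<integral>x. (\<Sum>k\<in>I. b k * Y k x) * Y m x \<partial>\<sigma>) = (\<integral>x. (\<Sum>k\<in>I. b k * (Y k x * Y m x)) \<partial>\<sigma>)"
    by (simp add: sum_distrib_right mult.assoc)
  also have "\<dots> = (\<Sum>k\<in>I. \<integral>x. b k * (Y k x * Y m x) \<partial>\<sigma>)"
    using assms
    by (intro Bochner_Integration.integral_sum integrable_sphere_measure continuous_intros continuous_Y)
  also have "\<dots> = (\<Sum>k\<in>I. if k = m then b k else 0)"
    using assms by (intro sum.cong) (auto simp: integral_YY)
  finally show ?thesis using assms by simp
qed

text \<open>The zonal function is an eigenfunction, hence on the sphere a combination of the basis;
  orthonormality identifies the coefficients.\<close>

lemma G_expansion:
  assumes x: "x \<in> S" and y: "y \<in> S"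
  shows "poly G (x \<bullet> y) = (\<Sum>m\<in>I. coeff_Y m y * Y m x)"
proof -
  have "(\<lambda>x. poly G (x \<bullet> y)) \<in> sphere_eigenspace (- (real l * (real l + real d - 1)))"
    using y by (intro gegenbauer_zonal_eigenfunction dim) auto
  then obtain b where b: "\<And>x. x \<in> S \<Longrightarrow> poly G (x \<bullet> y) = (\<Sum>m\<in>I. b m * Y m x)"
    using basis unfolding orthonormal_eigenbasis_def by meson
  have "coeff_Y m y = b m" if "m \<in> I" for m
  proof -
    have "coeff_Y m y = (\<integral>x. (\<Sum>k\<in>I. b k * Y k x) * Y m x \<partial>\<sigma>)"
      unfolding coeff_Y_def by (intro Bochner_Integration.integral_cong) (simp_all add: b)
    then show ?thesis by (simp only: integral_sum_Y that)
  qed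
  then show ?thesis using b[OF x] by simp
qed

lemma C_1: "poly (C l) 1 = pochhammer (real d - 1) l / fact l" and C_1_pos: "poly (C l) 1 > 0"
  and C_eq_G: "C l = smult (poly (C l) 1) G"
proof -
  have "2 * ((real d - 1) / 2) = real d - 1" by simp
  then show 1: "poly (C l) 1 = pochhammer (real d - 1) l / fact l"
    by (simp only: gegenbauer_at_1)
  show 2: "poly (C l) 1 > 0"
    unfolding 1 using d by (intro divide_pos_pos pochhammer_pos) auto
  show "C l = smult (poly (C l) 1) G"
    using 2 by (simp add: sphere_gegenbauer_def Let_def del: gegenbauer.simps)
qed

lemma N_pos: "real N > 0"
  using gegenbauer_norm_eigenspace_dim[OF d l] C_1_pos unfolding C_1
  by (metis mult_zero_right less_irrefl of_nat_0_eq_iff of_nat_0_less_iff gr0I)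

lemma C_orthogonal:
  assumes "j \<noteq> k" "norm y = 1" "norm z = 1"
  shows "(\<integral>x. poly (C j) (x \<bullet> y) * poly (C k) (x \<bullet> z) \<partial>\<sigma>) = 0"
proof -
  have "(real d - 1) / 2 = (real DIM('a) - 2) / 2" using dim by simp
  then show ?thesis
    using integral_sphere_gegenbauer_orthogonal[OF _ assms(2,3,1)] dim d by simp
qed

lemma integral_C_l:
  "(\<integral>x. f x * poly (C l) (x \<bullet> z) \<partial>\<sigma>) = poly (C l) 1 * (\<integral>x. f x * poly G (x \<bullet> z) \<partial>\<sigma>)"
proof -
  have "f x * poly (C l) (x \<bullet> z) = poly (C l) 1 * (f x * poly G (x \<bullet> z))" for x
    by (subst C_eq_G) simp
  then show ?thesis by (simp only: integral_mult_right_zero)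
qed

text \<open>Here \<open>gegenbauer_norm\<close> is applied to p -> integral of p(x . y), whose
  orthogonality is \<open>C_orthogonal\<close> with both poles equal to \<open>y\<close>. The
  dimension identity supplies a second factor C_l(1), and both factors disappear on passing from C_l
  to the normalized G.\<close>

lemma integral_G_square:
  assumes y: "norm y = 1"
  shows "(\<integral>x. poly G (x \<bullet> y) * poly G (x \<bullet> y) \<partial>\<sigma>) = sphere_area d / real N"
proof -
  let ?M = "\<lambda>p. \<integral>x. poly p (x \<bullet> y) \<partial>\<sigma>" and ?c = "poly (C l) 1"
  have "?M (C l * C l) = (real d - 1) / 2 / (real l + (real d - 1) / 2) *
      (pochhammer (2 * ((real d - 1) / 2)) l / fact l) * ?M 1"
  proof (rule gegenbauer_norm)
    show "?M (p + q) = ?M p + ?M q" for p q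
      by (simp, rule Bochner_Integration.integral_add; intro integrable_sphere_measure continuous_intros)
    show "?M (C j * C k) = 0" if "j \<noteq> k" for j k
      using C_orthogonal[OF that y y] by simp
  qed (use d in auto)
  also have "2 * ((real d - 1) / 2) = real d - 1" by simp
  also have "?M 1 = sphere_area d" using measure_sphere_measure[OF dim] by simp
  finally have "?M (C l * C l) * real N =
      ((real d - 1) / 2 / (real l + (real d - 1) / 2) * real N) * ?c * sphere_area d"
    unfolding C_1 by (simp only: mult_ac)
  also have "\<dots> = ?c * (?c * sphere_area d)"
    unfolding gegenbauer_norm_eigenspace_dim[OF d l] C_1 by (simp only: mult_ac)
  finally have "?M (C l * C l) * real N = ?c * (?c * sphere_area d)" .
  moreover have "?M (C l * C l) = ?c * (?c * ?M (G * G))"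
  proof -
    have "?M (C l * C l) = ?c * (\<integral>x. poly (C l) (x \<bullet> y) * poly G (x \<bullet> y) \<partial>\<sigma>)"
      unfolding poly_mult by (rule integral_C_l)
    also have "(\<integral>x. poly (C l) (x \<bullet> y) * poly G (x \<bullet> y) \<partial>\<sigma>) = ?c * ?M (G * G)"
      unfolding poly_mult using integral_C_l[of "\<lambda>x. poly G (x \<bullet> y)" y] by (simp only: mult.commute)
    finally show ?thesis .
  qed
  ultimately have "?c * (?c * (?M (G * G) * real N)) = ?c * (?c * sphere_area d)"
    by (simp only: mult.assoc)
  then have "?M (G * G) * real N = sphere_area d" using C_1_pos by simp
  then show ?thesis using N_pos by (simp add: field_simps)
qed

text \<open>Parseval's identity for the expansion of the zonal function.\<close>

lemma sum_coeff_Y_square: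
  assumes y: "y \<in> S"
  shows "(\<Sum>m\<in>I. (coeff_Y m y)\<^sup>2) = sphere_area d / real N"
proof -
  have "sphere_area d / real N = (\<integral>x. poly G (x \<bullet> y) * poly G (x \<bullet> y) \<partial>\<sigma>)"
    using y by (subst integral_G_square) auto
  also have "\<dots> = (\<integral>x. (\<Sum>m\<in>I. coeff_Y m y * (poly G (x \<bullet> y) * Y m x)) \<partial>\<sigma>)"
  proof (intro Bochner_Integration.integral_cong refl)
    fix x assume "x \<in> space \<sigma>"
    then have "poly G (x \<bullet> y) * poly G (x \<bullet> y) = poly G (x \<bullet> y) * (\<Sum>m\<in>I. coeff_Y m y * Y m x)"
      using G_expansion[OF _ y, of x] by simp
    then show "poly G (x \<bullet> y) * poly G (x \<bullet> y) = (\<Sum>m\<in>I. coeff_Y m y * (poly G (x \<bullet> y) * Y m x))"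
      by (simp add: sum_distrib_left mult_ac)
  qed
  also have "\<dots> = (\<Sum>m\<in>I. \<integral>x. coeff_Y m y * (poly G (x \<bullet> y) * Y m x) \<partial>\<sigma>)"
    by (intro Bochner_Integration.integral_sum integrable_sphere_measure continuous_intros continuous_Y)
  also have "\<dots> = (\<Sum>m\<in>I. (coeff_Y m y)\<^sup>2)"
    by (simp add: coeff_Y_def power2_eq_square)
  finally show ?thesis by simp
qed

lemma AE_Y_eq_coeff: "AE y in \<sigma>. \<forall>m\<in>I. Y m y = real N / sphere_area d * coeff_Y m y"
proof -
  let ?c = "real N / sphere_area d"
  \<comment> \<open>By orthonormality this is the squared L^2 distance in x between the kernel Z(x,
    y) and \<open>?c\<close> times the zonal function, as a function of y.\<close>
  define h where "h y = (\<Sum>m\<in>I. Y m y * Y m y) - ?c" for y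
  have h: "h y = (\<Sum>m\<in>I. (Y m y - ?c * coeff_Y m y)\<^sup>2)" if y: "y \<in> S" for y
  proof -
    \<comment> \<open>The expansion at x = y, where the normalization G(1) = 1 enters.\<close>
    have 1: "(\<Sum>m\<in>I. coeff_Y m y * Y m y) = 1"
      using G_expansion[OF y y] y sphere_gegenbauer_at_1[OF d] by (simp add: norm_eq_1)
    have "(\<Sum>m\<in>I. (Y m y - ?c * coeff_Y m y)\<^sup>2) =
        (\<Sum>m\<in>I. Y m y * Y m y) - 2 * ?c * (\<Sum>m\<in>I. coeff_Y m y * Y m y) + ?c\<^sup>2 * (\<Sum>m\<in>I. (coeff_Y m y)\<^sup>2)"
      by (simp only: sum_distrib_left sum_subtractf[symmetric] sum.distrib[symmetric])
        (simp add: algebra_simps power2_eq_square)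
    also have "\<dots> = h y"
      unfolding 1 sum_coeff_Y_square[OF y] h_def
      using N_pos sphere_area_pos[of d] by (simp add: field_simps power2_eq_square)
    finally show ?thesis ..
  qed
  have h_int: "integrable \<sigma> h"
    unfolding h_def[abs_def] by (intro integrable_sphere_measure continuous_intros continuous_Y)
  have "(\<integral>y. h y \<partial>\<sigma>) = (\<Sum>m\<in>I. \<integral>y. Y m y * Y m y \<partial>\<sigma>) - ?c * sphere_area d"
  proof -
    have "(\<integral>y. h y \<partial>\<sigma>) = (\<integral>y. (\<Sum>m\<in>I. Y m y * Y m y) \<partial>\<sigma>) - (\<integral>y. ?c \<partial>\<sigma>)"
      unfolding h_def
      by (intro Bochner_Integration.integral_diff integrable_sphere_measure continuous_intros continuous_Y)
    also have "(\<integral>y. (\<Sum>m\<in>I. Y m y * Y m y) \<partial>\<sigma>) = (\<Sum>m\<in>I. \<integral>y. Y m y * Y m y \<partial>\<sigma>)"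
      by (intro Bochner_Integration.integral_sum integrable_sphere_measure continuous_intros continuous_Y)
    finally show ?thesis using measure_sphere_measure[OF dim] by simp
  qed
  \<comment> \<open>There are N basis functions, each with square integral 1, and \<open>?c\<close>
    times the area is N as well.\<close>
  also have "\<dots> = 0"
    using sphere_area_pos[of d] by (simp add: integral_YY)
  finally have "AE y in \<sigma>. h y = 0"
    by (subst (asm) integral_nonneg_eq_0_iff_AE[OF h_int]) (auto intro!: AE_I2 sum_nonneg simp: h)
  then show ?thesis
    using AE_space
  proof eventually_elim
    case (elim y)
    then show ?case using h[of y] by (simp add: sum_nonneg_eq_0_iff)
  qed
qed

text \<open>
  The integrals \<open>J\<^sub>m\<close> of \<open>C\<^sub>k(x \<bullet> y) Y\<^sub>m(x)\<close> satisfy \<open>\<Sum>\<^sub>m J\<^sub>m Y\<^sub>m = 0\<close> almost everywhere, since \<open>C\<^sub>k(x \<bullet> y)\<close>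
  is orthogonal to all zonal functions of degree \<open>l\<close>.
\<close>

lemma integral_C_Y:
  assumes y: "norm y = 1" and "k \<noteq> l" and n: "n \<in> I"
  shows "(\<integral>x. poly (C k) (x \<bullet> y) * Y n x \<partial>\<sigma>) = 0"
proof -
  define J where "J m = (\<integral>x. poly (C k) (x \<bullet> y) * Y m x \<partial>\<sigma>)" for m
  have 0: "(\<Sum>m\<in>I. coeff_Y m z * J m) = 0" if z: "z \<in> S" for z
  proof -
    have "0 = (\<integral>x. poly (C k) (x \<bullet> y) * poly (C l) (x \<bullet> z) \<partial>\<sigma>)"
      using C_orthogonal[OF \<open>k \<noteq> l\<close> y] z by simp
    also have "\<dots> = poly (C l) 1 * (\<integral>x. poly (C k) (x \<bullet> y) * poly G (x \<bullet> z) \<partial>\<sigma>)"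
      by (rule integral_C_l)
    also have "(\<integral>x. poly (C k) (x \<bullet> y) * poly G (x \<bullet> z) \<partial>\<sigma>) =
        (\<integral>x. (\<Sum>m\<in>I. coeff_Y m z * (poly (C k) (x \<bullet> y) * Y m x)) \<partial>\<sigma>)"
      by (intro Bochner_Integration.integral_cong refl)
        (simp add: G_expansion[OF _ z] sum_distrib_left mult_ac)
    also have "\<dots> = (\<Sum>m\<in>I. coeff_Y m z * J m)"
      unfolding J_def
      by (subst Bochner_Integration.integral_sum)
        (auto intro!: integrable_sphere_measure continuous_intros continuous_Y)
    finally show ?thesis using C_1_pos by simp
  qed
  \<comment> \<open>By orthonormality J n is a coefficient of the sum of the J m Y m, a function
    that vanishes almost everywhere.\<close>
  have "J n = (\<integral>z. (\<Sum>m\<in>I. J m * Y m z) * Y n z \<partial>\<sigma>)"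
    by (simp only: integral_sum_Y n)
  also have "\<dots> = (\<integral>z. 0 \<partial>\<sigma>)"
  proof (rule integral_cong_AE)
    show "AE z in \<sigma>. (\<Sum>m\<in>I. J m * Y m z) * Y n z = 0"
      using AE_Y_eq_coeff AE_space
    proof eventually_elim
      case (elim z)
      then have "(\<Sum>m\<in>I. J m * Y m z) = real N / sphere_area d * (\<Sum>m\<in>I. coeff_Y m z * J m)"
        by (simp add: sum_distrib_left mult_ac)
      then show ?case using 0 elim by simp
    qed
  qed (use n in \<open>auto intro!: borel_measurable_integrable integrable_sphere_measure continuous_intros continuous_Y\<close>)
  finally show ?thesis by (simp add: J_def)
qed

text \<open>Both sides are linear in \<open>p\<close>, so Gegenbauer polynomials suffice: degrees
  other than l give 0 on both sides, and degree l is the assumed relation between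
  \<open>Y n y\<close> and \<open>coeff_Y n y\<close>.\<close>

lemma funk_hecke:
  assumes y: "norm y = 1" and Y: "\<forall>m\<in>I. Y m y = real N / sphere_area d * coeff_Y m y" and n: "n \<in> I"
  shows "(\<integral>x. poly p (x \<bullet> y) * Y n x \<partial>\<sigma>) = (\<integral>x. poly p (x \<bullet> y) * poly G (x \<bullet> y) \<partial>\<sigma>) * Y n y"
proof -
  let ?A = "\<lambda>p. \<integral>x. poly p (x \<bullet> y) * Y n x \<partial>\<sigma>" and ?B = "\<lambda>p. \<integral>x. poly p (x \<bullet> y) * poly G (x \<bullet> y) \<partial>\<sigma>"
  have "?A p - ?B p * Y n y = 0"
  proof (rule linear_functional_eq_0[where L = "\<lambda>p. ?A p - ?B p * Y n y"])
    show "(real d - 1) / 2 > 0" using d by simp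
    have "?A (p + q) = ?A p + ?A q" for p q
      unfolding poly_add distrib_right using n
      by (intro Bochner_Integration.integral_add integrable_sphere_measure continuous_intros continuous_Y)
    moreover have "?B (p + q) = ?B p + ?B q" for p q
      unfolding poly_add distrib_right
      by (intro Bochner_Integration.integral_add integrable_sphere_measure continuous_intros)
    ultimately show "?A (p + q) - ?B (p + q) * Y n y = ?A p - ?B p * Y n y + (?A q - ?B q * Y n y)" for p q
      by (simp only:) (simp add: algebra_simps)
    show "?A (smult c p) - ?B (smult c p) * Y n y = c * (?A p - ?B p * Y n y)" for c p
      by (simp add: mult.assoc right_diff_distrib)
    fix k
    show "?A (C k) - ?B (C k) * Y n y = 0"
    proof (cases "k = l")
      case True
      have "?A (C l) = poly (C l) 1 * coeff_Y n y"
        unfolding coeff_Y_def by (subst C_eq_G) (simp add: mult.assoc)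
      moreover have "?B (C l) = poly (C l) 1 * (sphere_area d / real N)"
        unfolding integral_G_square[OF y, symmetric] by (subst (1) C_eq_G) (simp add: mult.assoc)
      ultimately show ?thesis
        using Y n N_pos sphere_area_pos[of d] True by simp
    next
      case False
      have "?B (C k) = 0"
      proof -
        have "0 = (\<integral>x. poly (C k) (x \<bullet> y) * poly (C l) (x \<bullet> y) \<partial>\<sigma>)"
          using C_orthogonal[OF False y y] by simp
        also have "\<dots> = poly (C l) 1 * ?B (C k)"
          by (rule integral_C_l)
        finally show ?thesis using C_1_pos by simp
      qed
      then show ?thesis by (simp only: integral_C_Y[OF y False n])
    qed
  qed
  then show ?thesis by simp
qed

text \<open>At such a \<open>y\<close> the addition theorem turns the kernel into a multiple of G,
  so \<open>funk_hecke\<close> applies to G^r. The multiplier is the integral of G^(r+1), which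
  \<open>integral_sphere_zonal\<close> evaluates.\<close>

lemma integral_kernel_power:
  assumes y: "norm y = 1" and Y: "\<forall>m\<in>I. Y m y = real N / sphere_area d * coeff_Y m y" and n: "n \<in> I"
    and r: "r \<ge> 1"
  shows "(\<integral>x. (\<Sum>m\<in>I. Y m x * Y m y) ^ r * Y n x \<partial>\<sigma>) =
    (real N / sphere_area d) ^ (r - 1) * gamma_hat l r d * Y n y"
proof -
  let ?c = "real N / sphere_area d"
  have addition: "(\<Sum>m\<in>I. Y m x * Y m y) = ?c * poly G (x \<bullet> y)" if "x \<in> S" for x
    using G_expansion[OF that, of y] y Y by (simp add: sum_distrib_left mult_ac)
  have "(\<integral>x. (\<Sum>m\<in>I. Y m x * Y m y) ^ r * Y n x \<partial>\<sigma>) = (\<integral>x. ?c ^ r * (poly (G ^ r) (x \<bullet> y) * Y n x) \<partial>\<sigma>)"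
    by (intro Bochner_Integration.integral_cong refl) (simp only: addition space_sphere_measure power_mult_distrib poly_power mult.assoc)
  also have "\<dots> = ?c ^ r * ((\<integral>x. poly (G ^ r) (x \<bullet> y) * poly G (x \<bullet> y) \<partial>\<sigma>) * Y n y)"
    by (simp only: integral_mult_right_zero funk_hecke[OF y Y n])
  also have "(\<integral>x. poly (G ^ r) (x \<bullet> y) * poly G (x \<bullet> y) \<partial>\<sigma>) = (\<integral>x. poly (G ^ (r + 1)) (x \<bullet> y) \<partial>\<sigma>)"
    by (simp add: mult.commute)
  also have "\<dots> = sphere_area (d - 1) * (LBINT t:{-1..1}. poly G t ^ (r + 1) * sqrt (1 - t\<^sup>2) ^ (d - 2))"
    using integral_sphere_zonal[OF dim d y, of "G ^ (r + 1)"] by (simp only: poly_power)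
  \<comment> \<open>One factor \<open>?c\<close> is absorbed into the prefactor of
    \<open>gamma_hat\<close>; splitting it off uses r >= 1.\<close>
  also have "?c ^ r = ?c ^ (r - 1) * ?c"
    using r by (metis power_minus_mult less_le_trans zero_less_one)
  finally show ?thesis
    unfolding gamma_hat_def by (simp only: times_divide_eq_right times_divide_eq_left mult_ac)
qed

text \<open>The integrals stay iterated: for fixed y the finite sum over \<open>ms\<close> moves
  inside the x-integral, where it becomes the r-th power of the kernel. The exceptional y of
  \<open>AE_Y_eq_coeff\<close> form a null set and do not affect the outer integral.\<close>

lemma sum_gaunt:
  assumes r: "r \<ge> 1" and n: "n \<in> I" and ns: "set ns \<subseteq> I"
  shows "(\<Sum>ms | length ms = r \<and> set ms \<subseteq> I. gaunt Y (ms @ [n]) * gaunt Y (ms @ ns)) =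
    (real N / sphere_area d) ^ (r - 1) * gamma_hat l r d * gaunt Y (n # ns)"
proof -
  let ?L = "{ms. length ms = r \<and> set ms \<subseteq> I}"
  define P where "P ms x = (\<Prod>k\<leftarrow>ms. Y k x)" for ms and x :: 'a
  have P: "continuous_on S (P ms)" if "set ms \<subseteq> I" for ms
    unfolding P_def using that by (intro continuous_on_prod_list continuous_Y) auto
  have P_int: "integrable \<sigma> (\<lambda>x. b * (P ms x * Y n x))" "integrable \<sigma> (\<lambda>x. b * (P ms x * P ns x))"
    if "ms \<in> ?L" for ms b
    using that ns n by (intro integrable_sphere_measure continuous_intros P continuous_Y; auto)+
  have gaunt: "gaunt Y (ms @ [n]) = (\<integral>x. P ms x * Y n x \<partial>\<sigma>)" "gaunt Y (ms @ ns) = (\<integral>y. P ms y * P ns y \<partial>\<sigma>)" for ms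
    by (simp_all add: gaunt_def P_def)
  have "(\<Prod>k\<leftarrow>ms. Y k x * Y k y) = P ms x * P ms y" for ms x y
    unfolding P_def by (induction ms) (simp_all add: mult_ac)
  then have kernel: "(\<Sum>ms\<in>?L. P ms x * P ms y) = (\<Sum>m\<in>I. Y m x * Y m y) ^ r" for x y
    by (simp only: sum_prod_list_power[OF finite_atLeastAtMost, symmetric])
  have "(\<Sum>ms\<in>?L. gaunt Y (ms @ [n]) * gaunt Y (ms @ ns)) =
      (\<Sum>ms\<in>?L. \<integral>y. gaunt Y (ms @ [n]) * (P ms y * P ns y) \<partial>\<sigma>)"
    by (simp add: gaunt)
  also have "\<dots> = (\<integral>y. (\<Sum>ms\<in>?L. gaunt Y (ms @ [n]) * (P ms y * P ns y)) \<partial>\<sigma>)"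
    by (rule Bochner_Integration.integral_sum[symmetric]) (rule P_int)
  also have "\<dots> = (\<integral>y. (real N / sphere_area d) ^ (r - 1) * gamma_hat l r d * (Y n y * P ns y) \<partial>\<sigma>)"
  proof (rule integral_cong_AE)
    show "AE y in \<sigma>. (\<Sum>ms\<in>?L. gaunt Y (ms @ [n]) * (P ms y * P ns y)) =
      (real N / sphere_area d) ^ (r - 1) * gamma_hat l r d * (Y n y * P ns y)"
      using AE_Y_eq_coeff AE_space
    proof eventually_elim
      case (elim y)
      have "(\<Sum>ms\<in>?L. gaunt Y (ms @ [n]) * (P ms y * P ns y)) =
          (\<Sum>ms\<in>?L. \<integral>x. P ms y * (P ms x * Y n x) \<partial>\<sigma>) * P ns y"
        by (simp only: gaunt integral_mult_right_zero sum_distrib_right) (simp only: mult_ac)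
      also have "(\<Sum>ms\<in>?L. \<integral>x. P ms y * (P ms x * Y n x) \<partial>\<sigma>) =
          (\<integral>x. (\<Sum>ms\<in>?L. P ms y * (P ms x * Y n x)) \<partial>\<sigma>)"
        by (rule Bochner_Integration.integral_sum[symmetric]) (rule P_int)
      also have "\<dots> = (\<integral>x. (\<Sum>m\<in>I. Y m x * Y m y) ^ r * Y n x \<partial>\<sigma>)"
        unfolding kernel[symmetric] by (simp only: sum_distrib_right) (simp only: mult_ac)
      also have "\<dots> = (real N / sphere_area d) ^ (r - 1) * gamma_hat l r d * Y n y"
        using elim by (intro integral_kernel_power n r) auto
      finally show ?case by (simp add: mult.assoc)
    qed
  qed (use n ns in \<open>auto intro!: borel_measurable_integrable integrable_sphere_measure continuous_intros continuous_Y P\<close>)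
  also have "\<dots> = (real N / sphere_area d) ^ (r - 1) * gamma_hat l r d * gaunt Y (n # ns)"
    by (simp add: gaunt_def P_def)
  finally show ?thesis .
qed

end

theorem lemma3p1p12:
  fixes Y :: "nat \<Rightarrow> 'a::euclidean_space \<Rightarrow> real"
    and d l r q n :: nat and ns :: "nat list"
  assumes "DIM('a) = d + 1" and "d \<ge> 2" and "l \<ge> 1" and "r \<ge> 1"
    and "orthonormal_eigenbasis (- (real l * (real l + real d - 1))) {1..eigenspace_dim l d} Y"
    and "n \<in> {1..eigenspace_dim l d}"
    and "length ns = q" and "set ns \<subseteq> {1..eigenspace_dim l d}"
  shows "(\<Sum>ms | length ms = r \<and> set ms \<subseteq> {1..eigenspace_dim l d}.
            gaunt Y (ms @ [n]) * gaunt Y (ms @ ns)) =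
         (real (eigenspace_dim l d) / sphere_area d) ^ (r - 1) * gamma_hat l r d * gaunt Y (n # ns)"
proof -
  interpret sphere_harmonic_basis Y d l
    by standard (fact assms)+
  show ?thesis using assms by (intro sum_gaunt)
qed

end
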